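(* For each coarse space $X$, the finite-join partially ordered sets $\mathcal P_c(X)$ (of coarse subspaces of $X$) and $\mathrm{Sub}(X)$ (of subobjects of $X$ in the category of coarse spaces $\mathbf{Coarse}_{\mathrm{CtrTotRel}}/\mathrm{close}$) are isomorphic. Moreover, the two functors $\mathcal P_c$ and $\mathrm{Sub}$ from $\mathbf{Coarse}_{\mathrm{CtrTotRel}}/\mathrm{close}$ to $\mathbf{FJ}\text{-}\mathbf{Par}$ are naturally isomorphic.
   Context: Throughout, "set" (underlying a coarse space) means an element of a fixed universe $\mathcal U$ with $\mathbb N\in\mathcal U$; partially ordered sets are elements of a fixed universe $\mathcal V$ with $\mathcal U\in\mathcal V$. Relations. For sets $X,Y$, a relation from $X$ to $Y$ is a subset $R\subset Y\times X$; $\mathrm{Rel}(X,Y)=\mathcal P(Y\times X)$, $\mathrm{Rel}(X)=\mathrm{Rel}(X,X)$. $S\circ R=\{(z,x)\mid \exists y,\ (z,y)\in S,\ (y,x)\in R\}$; $1_X^{\mathrm{Rel}}=\{(x,x)\mid x\in X\}$; $R^\dagger=\{(x,y)\mid (y,x)\in R\}$; $\mathrm{Ad}_R(E)=R\circ E\circ R^\dagger$ for $E\in\mathrm{Rel}(X)$; $R(S)=\{y\in Y\mid \exists s\in S,\ (y,s)\in R\}$ for $S\subset X$. $R$ is total if for every $x\in X$ there is $y\in Y$ with $(y,x)\in R$. Coarse spaces. A coarse structure on $X$ is a subset $\mathcal E\subset\mathrm{Rel}(X)$ containing $1_X^{\mathrm{Rel}}$ and closed under composition, dagger, finite unions and passing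 to subsets; a coarse space is a pair $X=(X,\mathcal E_X)$. A relation $\eta\in\mathrm{Rel}(X,Y)$ between coarse spaces is controlled if $\mathrm{Ad}_\eta(E)\in\mathcal E_Y$ for all $E\in\mathcal E_X$; $\mathrm{CtrTotRel}(X,Y)$ is the set of controlled total relations. For relations, $\eta_1\prec\eta_2$ means $\eta_1\subset F\circ\eta_2\circ E$ for some $E\in\mathcal E_X,F\in\mathcal E_Y$; $\eta_1\sim\eta_2$ ("close") means $\eta_1\prec\eta_2$ and $\eta_2\prec\eta_1$. $\mathbf{Coarse}_{\mathrm{CtrTotRel}}/\mathrm{close}$ is the category whose objects are coarse spaces and whose morphisms $X\to Y$ are the $\sim$-classes $[\eta]$ of $\eta\in\mathrm{CtrTotRel}(X,Y)$, with $[\xi]\circ[\eta]=[\xi\circ\eta]$ and identities $[1_X^{\mathrm{Rel}}]$. Order categories. A partially ordered set is finite join if every finite subset (including $\emptyset$) has a least upper bound. $\mathbf{FJ}\text{-}\mathbf{Par}$ has finite-join partially ordered sets as objects and order-preserving maps preserving finite joins as morphisms. The functor $\mathcal P_c$. For a coarse space $X$ and $A,B\subset X$, $A\prec B$ means there is $E\in\mathcal E_X$ with $A\subset E(B)$. $\mathcal P_c(X)$ is the quotient of $\mathcal P(X)$ by $A\sim B\iff(A\prec B$ and $B\prec A)$, with the induced partial order; its elements $[S]$ are called coarse subspaces of $X$. It is finite join. On morphisms, $[\eta]^{\mathcal P_c}:\mathcal P_c(X)\to\mathcal P_c(Y)$, $[S]\mapsto[\eta(S)]$. The functor $\mathrm{Sub}$.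 Let $\mathcal E$ and $\mathcal M$ be the classes of epimorphisms and monomorphisms of $\mathbf{Coarse}_{\mathrm{CtrTotRel}}/\mathrm{close}$; $(\mathcal E,\mathcal M)$ is an orthogonal factorization system on this category, which is also finitely cocomplete (known facts). $\mathrm{Sub}(X)$ is the set of isomorphism classes $[h]$ of monomorphisms $h:Z\to X$ (as objects over $X$), partially ordered by $[h_1]\prec[h_2]$ iff there is a morphism $\phi$ with $h_2\circ\phi=h_1$; it is finite join. For a morphism $[\eta]:X\to Y$, the map $\mathrm{Sub}([\eta]):\mathrm{Sub}(X)\to\mathrm{Sub}(Y)$ sends $[h]$ to $[m]$, where $[\eta]\circ h=m\circ e$ is a factorization with $e\in\mathcal E$ and $m\in\mathcal M$; this is well defined, preserves finite joins and makes $\mathrm{Sub}$ a functor to $\mathbf{FJ}\text{-}\mathbf{Par}$. *)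

theory Defs
  imports "HOL-Algebra.Order" "HOL-Library.FuncSet" "HOL-Library.Equipollence"
begin

section \<open>Categories, subobjects, functors\<close>

text \<open>Morphisms do not carry their endpoints, hence composition \<open>Comp C X Y Z g f\<close>
  of \<open>f : X \<rightarrow> Y\<close> and \<open>g : Y \<rightarrow> Z\<close> takes the three objects as arguments.\<close>

record ('o, 'm) cat =
  Ob :: "'o set"
  Hom :: "'o \<Rightarrow> 'o \<Rightarrow> 'm set"
  Comp :: "'o \<Rightarrow> 'o \<Rightarrow> 'o \<Rightarrow> 'm \<Rightarrow> 'm \<Rightarrow> 'm"
  Ident :: "'o \<Rightarrow> 'm"

locale category =
  fixes C :: "('o, 'm) cat"
  assumes comp_in_hom:
      "\<lbrakk>X \<in> Ob C; Y \<in> Ob C; Z \<in> Ob C; f \<in> Hom C X Y; g \<in> Hom C Y Z\<rbrakk>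
        \<Longrightarrow> Comp C X Y Z g f \<in> Hom C X Z"
    and ident_in_hom: "X \<in> Ob C \<Longrightarrow> Ident C X \<in> Hom C X X"
    and comp_ident_right:
      "\<lbrakk>X \<in> Ob C; Y \<in> Ob C; f \<in> Hom C X Y\<rbrakk> \<Longrightarrow> Comp C X X Y f (Ident C X) = f"
    and comp_ident_left:
      "\<lbrakk>X \<in> Ob C; Y \<in> Ob C; f \<in> Hom C X Y\<rbrakk> \<Longrightarrow> Comp C X Y Y (Ident C Y) f = f"
    and comp_assoc:
      "\<lbrakk>W \<in> Ob C; X \<in> Ob C; Y \<in> Ob C; Z \<in> Ob C;
        f \<in> Hom C W X; g \<in> Hom C X Y; h \<in> Hom C Y Z\<rbrakk>
        \<Longrightarrow> Comp C W Y Z h (Comp C W X Y g f) = Comp C W X Z (Comp C X Y Z h g) f"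

definition monic :: "('o, 'm) cat \<Rightarrow> 'o \<Rightarrow> 'o \<Rightarrow> 'm \<Rightarrow> bool" where
  "monic C X Y m \<longleftrightarrow> m \<in> Hom C X Y \<and>
    (\<forall>W \<in> Ob C. \<forall>g \<in> Hom C W X. \<forall>h \<in> Hom C W X.
      Comp C W X Y m g = Comp C W X Y m h \<longrightarrow> g = h)"

definition epic :: "('o, 'm) cat \<Rightarrow> 'o \<Rightarrow> 'o \<Rightarrow> 'm \<Rightarrow> bool" where
  "epic C X Y e \<longleftrightarrow> e \<in> Hom C X Y \<and>
    (\<forall>W \<in> Ob C. \<forall>g \<in> Hom C Y W. \<forall>h \<in> Hom C Y W.
      Comp C X Y W g e = Comp C X Y W h e \<longrightarrow> g = h)"

definition is_iso :: "('o, 'm) cat \<Rightarrow> 'o \<Rightarrow> 'o \<Rightarrow> 'm \<Rightarrow> bool" where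
  "is_iso C X Y f \<longleftrightarrow> f \<in> Hom C X Y \<and>
    (\<exists>g \<in> Hom C Y X. Comp C X Y X g f = Ident C X \<and> Comp C Y X Y f g = Ident C Y)"

definition isomorphic :: "('o, 'm) cat \<Rightarrow> 'o \<Rightarrow> 'o \<Rightarrow> bool" where
  "isomorphic C X Y \<longleftrightarrow> X \<in> Ob C \<and> Y \<in> Ob C \<and> (\<exists>f. is_iso C X Y f)"

text \<open>A monomorphism \<open>h : Z \<rightarrow> X\<close> is represented by the pair \<open>(Z, h)\<close>.\<close>

definition monos_into :: "('o, 'm) cat \<Rightarrow> 'o \<Rightarrow> ('o \<times> 'm) set" where
  "monos_into C X = {(Z, h). Z \<in> Ob C \<and> monic C Z X h}"

definition iso_over :: "('o, 'm) cat \<Rightarrow> 'o \<Rightarrow> (('o \<times> 'm) \<times> ('o \<times> 'm)) set" where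
  "iso_over C X = {((Z1, h1), (Z2, h2)).
     (Z1, h1) \<in> monos_into C X \<and> (Z2, h2) \<in> monos_into C X \<and>
     (\<exists>\<phi>. is_iso C Z1 Z2 \<phi> \<and> Comp C Z1 Z2 X h2 \<phi> = h1)}"

definition Sub :: "('o, 'm) cat \<Rightarrow> 'o \<Rightarrow> ('o \<times> 'm) set gorder" where
  "Sub C X = \<lparr>
     carrier = monos_into C X // iso_over C X,
     eq = (=),
     le = (\<lambda>a b. \<exists>(Z1, h1) \<in> a. \<exists>(Z2, h2) \<in> b.
            \<exists>\<phi> \<in> Hom C Z1 Z2. Comp C Z1 Z2 X h2 \<phi> = h1)\<rparr>"

text \<open>The union runs over all representatives \<open>(Z, h)\<close> and all epi-mono factorizations
  \<open>f \<circ> h = m \<circ> e\<close> through objects \<open>I\<close>. When the class of \<open>(I, m)\<close> does not depend on these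
  choices, it is a union of copies of that single class.\<close>

definition Sub_map ::
    "('o, 'm) cat \<Rightarrow> 'o \<Rightarrow> 'o \<Rightarrow> 'm \<Rightarrow> ('o \<times> 'm) set \<Rightarrow> ('o \<times> 'm) set" where
  "Sub_map C X Y f = (\<lambda>a \<in> carrier (Sub C X).
     \<Union>{iso_over C Y `` {(I, m)} | Z h I m e.
        (Z, h) \<in> a \<and> I \<in> Ob C \<and> epic C Z I e \<and> monic C I Y m \<and>
        Comp C Z X Y f h = Comp C Z I Y m e})"

record ('o, 'm, 'p, 'n) cfunctor =
  FOb :: "'o \<Rightarrow> 'p"
  FMor :: "'o \<Rightarrow> 'o \<Rightarrow> 'm \<Rightarrow> 'n"

definition cat_functor ::
    "('o, 'm) cat \<Rightarrow> ('p, 'n) cat \<Rightarrow> ('o, 'm, 'p, 'n) cfunctor \<Rightarrow> bool" where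
  "cat_functor C D F \<longleftrightarrow> category C \<and> category D \<and>
    (\<forall>X \<in> Ob C. FOb F X \<in> Ob D) \<and>
    (\<forall>X \<in> Ob C. \<forall>Y \<in> Ob C. \<forall>f \<in> Hom C X Y. FMor F X Y f \<in> Hom D (FOb F X) (FOb F Y)) \<and>
    (\<forall>X \<in> Ob C. FMor F X X (Ident C X) = Ident D (FOb F X)) \<and>
    (\<forall>X \<in> Ob C. \<forall>Y \<in> Ob C. \<forall>Z \<in> Ob C. \<forall>f \<in> Hom C X Y. \<forall>g \<in> Hom C Y Z.
      FMor F X Z (Comp C X Y Z g f) =
      Comp D (FOb F X) (FOb F Y) (FOb F Z) (FMor F Y Z g) (FMor F X Y f))"

definition naturally_isomorphic ::
    "('o, 'm) cat \<Rightarrow> ('p, 'n) cat \<Rightarrow> ('o, 'm, 'p, 'n) cfunctor \<Rightarrow>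
     ('o, 'm, 'p, 'n) cfunctor \<Rightarrow> bool" where
  "naturally_isomorphic C D F G \<longleftrightarrow> cat_functor C D F \<and> cat_functor C D G \<and>
    (\<exists>\<tau>. (\<forall>X \<in> Ob C. is_iso D (FOb F X) (FOb G X) (\<tau> X)) \<and>
         (\<forall>X \<in> Ob C. \<forall>Y \<in> Ob C. \<forall>f \<in> Hom C X Y.
            Comp D (FOb F X) (FOb F Y) (FOb G Y) (\<tau> Y) (FMor F X Y f) =
            Comp D (FOb F X) (FOb G X) (FOb G Y) (FMor G X Y f) (\<tau> X)))"

section \<open>Finite-join partially ordered sets\<close>

definition finite_join :: "'v gorder \<Rightarrow> bool" where
  "finite_join P \<longleftrightarrow> partial_order P \<and>
    (\<forall>S. finite S \<and> S \<subseteq> carrier P \<longrightarrow> (\<exists>x. is_lub P x S))"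

definition FJ_Hom :: "'v gorder \<Rightarrow> 'v gorder \<Rightarrow> ('v \<Rightarrow> 'v) set" where
  "FJ_Hom P Q = {f \<in> carrier P \<rightarrow>\<^sub>E carrier Q. isotone P Q f \<and>
    (\<forall>S x. finite S \<and> S \<subseteq> carrier P \<and> is_lub P x S \<longrightarrow> is_lub Q (f x) (f ` S))}"

definition FJ_Par :: "('v gorder, 'v \<Rightarrow> 'v) cat" where
  "FJ_Par = \<lparr>
     Ob = {P. finite_join P},
     Hom = FJ_Hom,
     Comp = (\<lambda>P Q R g f. compose (carrier P) g f),
     Ident = (\<lambda>P. \<lambda>x \<in> carrier P. x)\<rparr>"

text \<open>The two functors below take values in posets over different types. To have a common
  target category, their elements are renamed along injections \<open>i\<close> into one type.\<close>

definition rename :: "('p \<Rightarrow> 'v) \<Rightarrow> 'p gorder \<Rightarrow> 'v gorder" where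
  "rename i P = \<lparr>
     carrier = i ` carrier P,
     eq = (=),
     le = (\<lambda>a b. \<exists>x \<in> carrier P. \<exists>y \<in> carrier P. a = i x \<and> b = i y \<and> x \<sqsubseteq>\<^bsub>P\<^esub> y)\<rparr>"

definition rename_map :: "('p \<Rightarrow> 'v) \<Rightarrow> 'p gorder \<Rightarrow> ('p \<Rightarrow> 'p) \<Rightarrow> 'v \<Rightarrow> 'v" where
  "rename_map i P f = (\<lambda>a \<in> i ` carrier P. i (f (inv i a)))"

section \<open>Coarse spaces\<close>

text \<open>The universe of sets is modelled by a family \<open>U\<close> of subsets of a type. Every
  Grothendieck universe containing the natural numbers, whose elements are subsets of it, is
  such a family; so is the family of all subsets of an arbitrary infinite type. Closure under
  power sets and under unions is not required.\<close>

definition set_universe :: "'a set set \<Rightarrow> bool" where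
  "set_universe U \<longleftrightarrow>
    (\<exists>N \<in> U. infinite N) \<and>
    (\<forall>A \<in> U. \<forall>B. B \<subseteq> A \<longrightarrow> B \<in> U) \<and>
    (\<forall>A \<in> U. \<forall>B \<in> U. \<exists>P \<in> U. P \<approx> A \<times> B)"

lemma set_universe_UNIV:
  assumes "infinite (UNIV :: 'a set)"
  shows "set_universe (UNIV :: 'a set set)"
proof -
  have "\<exists>P \<in> (UNIV :: 'a set set). P \<approx> A \<times> B" for A B :: "'a set"
  proof -
    have "A \<times> B \<lesssim> (UNIV :: 'a set) \<times> (UNIV :: 'a set)"
      by (rule subset_imp_lepoll) simp
    also have "(UNIV :: 'a set) \<times> (UNIV :: 'a set) \<approx> (UNIV :: 'a set)"
      using card_of_Times_same_infinite[OF assms]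
      by (simp add: eqpoll_def card_of_ordIso)
    finally obtain f :: "'a \<times> 'a \<Rightarrow> 'a" where "inj_on f (A \<times> B)"
      by (auto simp: lepoll_def)
    then have "f ` (A \<times> B) \<approx> A \<times> B"
      by (rule inj_on_image_eqpoll_self)
    then show ?thesis
      by blast
  qed
  then show ?thesis
    using assms by (auto simp: set_universe_def)
qed

text \<open>A relation from \<open>X\<close> to \<open>Y\<close> is a subset of \<open>Y \<times> X\<close>: its pairs are \<open>(target, source)\<close>.
  With this convention the composite \<open>S \<circ> R\<close> is \<open>S O R\<close>.\<close>

definition Ad :: "('b \<times> 'a) set \<Rightarrow> ('a \<times> 'a) set \<Rightarrow> ('b \<times> 'b) set" where
  "Ad R E = R O E O R\<inverse>"

definition rel_image :: "('b \<times> 'a) set \<Rightarrow> 'a set \<Rightarrow> 'b set" where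
  "rel_image R S = {y. \<exists>s \<in> S. (y, s) \<in> R}"

definition coarse_structure :: "'a set \<Rightarrow> ('a \<times> 'a) set set \<Rightarrow> bool" where
  "coarse_structure X \<E> \<longleftrightarrow>
    \<E> \<subseteq> Pow (X \<times> X) \<and> Id_on X \<in> \<E> \<and>
    (\<forall>E \<in> \<E>. \<forall>F \<in> \<E>. E O F \<in> \<E>) \<and>
    (\<forall>E \<in> \<E>. E\<inverse> \<in> \<E>) \<and>
    (\<forall>\<F>. finite \<F> \<and> \<F> \<subseteq> \<E> \<longrightarrow> \<Union>\<F> \<in> \<E>) \<and>
    (\<forall>E \<in> \<E>. \<forall>F. F \<subseteq> E \<longrightarrow> F \<in> \<E>)"

record 'a coarse = "'a partial_object" +
  entourages :: "('a \<times> 'a) set set"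

definition CtrTotRel :: "'a coarse \<Rightarrow> 'a coarse \<Rightarrow> ('a \<times> 'a) set set" where
  "CtrTotRel X Y = {\<eta>. \<eta> \<subseteq> carrier Y \<times> carrier X \<and>
     (\<forall>E \<in> entourages X. Ad \<eta> E \<in> entourages Y) \<and>
     (\<forall>x \<in> carrier X. \<exists>y \<in> carrier Y. (y, x) \<in> \<eta>)}"

definition rel_prec :: "'a coarse \<Rightarrow> 'a coarse \<Rightarrow> ('a \<times> 'a) set \<Rightarrow> ('a \<times> 'a) set \<Rightarrow> bool" where
  "rel_prec X Y \<eta>1 \<eta>2 \<longleftrightarrow>
    (\<exists>E \<in> entourages X. \<exists>F \<in> entourages Y. \<eta>1 \<subseteq> F O \<eta>2 O E)"

definition close :: "'a coarse \<Rightarrow> 'a coarse \<Rightarrow> (('a \<times> 'a) set \<times> ('a \<times> 'a) set) set" where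
  "close X Y = {(\<eta>1, \<eta>2). \<eta>1 \<in> CtrTotRel X Y \<and> \<eta>2 \<in> CtrTotRel X Y \<and>
     rel_prec X Y \<eta>1 \<eta>2 \<and> rel_prec X Y \<eta>2 \<eta>1}"

definition Coarse :: "'a set set \<Rightarrow> ('a coarse, ('a \<times> 'a) set set) cat" where
  "Coarse U = \<lparr>
     Ob = {X. carrier X \<in> U \<and> coarse_structure (carrier X) (entourages X)},
     Hom = (\<lambda>X Y. CtrTotRel X Y // close X Y),
     Comp = (\<lambda>X Y Z g f. \<Union>\<xi> \<in> g. \<Union>\<eta> \<in> f. close X Z `` {\<xi> O \<eta>}),
     Ident = (\<lambda>X. close X X `` {Id_on (carrier X)})\<rparr>"

section \<open>Coarse subspaces\<close>

definition set_prec :: "'a coarse \<Rightarrow> 'a set \<Rightarrow> 'a set \<Rightarrow> bool" where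
  "set_prec X A B \<longleftrightarrow> (\<exists>E \<in> entourages X. A \<subseteq> rel_image E B)"

definition set_sim :: "'a coarse \<Rightarrow> ('a set \<times> 'a set) set" where
  "set_sim X = {(A, B). A \<subseteq> carrier X \<and> B \<subseteq> carrier X \<and> set_prec X A B \<and> set_prec X B A}"

definition Pc :: "'a coarse \<Rightarrow> 'a set set gorder" where
  "Pc X = \<lparr>
     carrier = Pow (carrier X) // set_sim X,
     eq = (=),
     le = (\<lambda>a b. \<exists>A \<in> a. \<exists>B \<in> b. set_prec X A B)\<rparr>"

definition Pc_map ::
    "'a coarse \<Rightarrow> 'a coarse \<Rightarrow> ('a \<times> 'a) set set \<Rightarrow> 'a set set \<Rightarrow> 'a set set" where
  "Pc_map X Y f = (\<lambda>a \<in> carrier (Pc X). \<Union>\<eta> \<in> f. \<Union>S \<in> a. set_sim Y `` {rel_image \<eta> S})"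

section \<open>The two functors\<close>

type_synonym 'a subobject = "('a coarse \<times> ('a \<times> 'a) set set) set"

type_synonym 'a fj_poset = "('a set set + 'a subobject) gorder"

type_synonym 'a fj_map = "'a set set + 'a subobject \<Rightarrow> 'a set set + 'a subobject"

definition Pc_functor ::
    "('a coarse, ('a \<times> 'a) set set, 'a fj_poset, 'a fj_map) cfunctor" where
  "Pc_functor = \<lparr>
     FOb = (\<lambda>X. rename Inl (Pc X)),
     FMor = (\<lambda>X Y f. rename_map Inl (Pc X) (Pc_map X Y f))\<rparr>"

definition Sub_functor ::
    "'a set set \<Rightarrow> ('a coarse, ('a \<times> 'a) set set, 'a fj_poset, 'a fj_map) cfunctor" where
  "Sub_functor U = \<lparr>
     FOb = (\<lambda>X. rename Inr (Sub (Coarse U) X)),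
     FMor = (\<lambda>X Y f. rename_map Inr (Sub (Coarse U) X) (Sub_map (Coarse U) X Y f))\<rparr>"

end

theory Submission
  imports Defs
begin

text \<open>The isomorphism sends a coarse subspace \<open>[S]\<close> of \<open>X\<close> to the class of the inclusion
  \<open>S \<rightarrow> X\<close>, where \<open>S\<close> carries the restricted coarse structure; its inverse sends a monomorphism to
  the coarse subspace given by its range.

  Two descriptions make this work. A morphism \<open>[\<eta>] : X \<rightarrow> Y\<close> is monic iff \<open>\<eta>\<close> is a coarse embedding,
  meaning that entourages of \<open>Y\<close> pull back to entourages of \<open>X\<close> (\<open>monic_mor_iff\<close>), and it is epic
  iff every point of \<open>Y\<close> lies uniformly close to the range of \<open>\<eta>\<close> (\<open>epic_mor_iff\<close>). That monic
  and epic morphisms have these properties is seen on test objects: a discrete space whose points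
  are the pairs of a pulled-back entourage in the first case, two copies of \<open>Y\<close> glued along the range
  in the second. The closure properties of the universe provide them.

  Given a coarse embedding \<open>\<eta>2\<close>, a morphism \<open>[\<eta>1]\<close> with the same target factors through \<open>[\<eta>2]\<close> iff
  the range of \<open>\<eta>1\<close> is \<open>\<prec>\<close> the range of \<open>\<eta>2\<close>: the factorization is \<open>\<eta>2\<dagger> \<circ> F\<dagger> \<circ> \<eta>1\<close> for an
  entourage \<open>F\<close> witnessing that relation (\<open>factors_through_embedding_iff\<close>). So the order on
  subobjects is the order on their ranges, and every coarse subspace is a range; this is
  \<open>order_iso_Pc_Sub\<close>. For naturality, if \<open>[\<xi>] \<circ> [\<eta>] = [\<mu>] \<circ> [\<epsilon>]\<close> with \<open>[\<epsilon>]\<close> epic, then the range of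
  \<open>\<mu>\<close> agrees up to closeness with the image under \<open>\<xi>\<close> of the range of \<open>\<eta>\<close>
  (\<open>Sub_map_subobjects_onto\<close>).

  Finite joins and functoriality are verified by hand only for \<open>\<P>\<^sub>c\<close>, where joins are unions.
  For the subobjects both are transported along the isomorphism, and so they are for the renamed
  copies of the two functors that live in a common type (\<open>cat_functor_transport\<close>).\<close>

section \<open>Transporting functors along order isomorphisms\<close>

lemma partial_orderI:
  assumes "eq P = (=)"
    and "\<And>x. x \<in> carrier P \<Longrightarrow> x \<sqsubseteq>\<^bsub>P\<^esub> x"
    and "\<And>x y. \<lbrakk>x \<in> carrier P; y \<in> carrier P; x \<sqsubseteq>\<^bsub>P\<^esub> y; y \<sqsubseteq>\<^bsub>P\<^esub> x\<rbrakk> \<Longrightarrow> x = y"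
    and "\<And>x y z. \<lbrakk>x \<in> carrier P; y \<in> carrier P; z \<in> carrier P; x \<sqsubseteq>\<^bsub>P\<^esub> y; y \<sqsubseteq>\<^bsub>P\<^esub> z\<rbrakk>
      \<Longrightarrow> x \<sqsubseteq>\<^bsub>P\<^esub> z"
  shows "partial_order P"
proof
  fix x y assume "x \<in> carrier P" "y \<in> carrier P" "x \<sqsubseteq>\<^bsub>P\<^esub> y" "y \<sqsubseteq>\<^bsub>P\<^esub> x"
  then show "x .=\<^bsub>P\<^esub> y" using assms(1,3) by simp
next
  fix x y z
  assume "x \<in> carrier P" "y \<in> carrier P" "z \<in> carrier P" "x \<sqsubseteq>\<^bsub>P\<^esub> y" "y \<sqsubseteq>\<^bsub>P\<^esub> z"
  then show "x \<sqsubseteq>\<^bsub>P\<^esub> z" using assms(4) by blast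
qed (simp_all add: assms(1,2))

lemma is_lub_iff:
  "is_lub P x S \<longleftrightarrow> x \<in> carrier P \<and> (\<forall>s \<in> S \<inter> carrier P. s \<sqsubseteq>\<^bsub>P\<^esub> x) \<and>
    (\<forall>u \<in> carrier P. (\<forall>s \<in> S \<inter> carrier P. s \<sqsubseteq>\<^bsub>P\<^esub> u) \<longrightarrow> x \<sqsubseteq>\<^bsub>P\<^esub> u)"
  unfolding least_def Upper_def by blast

lemma is_lub_unique:
  assumes "partial_order P" "is_lub P x S" "is_lub P y S"
  shows "x = y"
proof -
  interpret partial_order P by fact
  show ?thesis using assms(2,3) unfolding is_lub_iff by (blast intro: le_antisym)
qed

text \<open>Requiring the equivalence of the target to be equality makes the target a partial order
  whenever the source is one.\<close>

definition order_iso :: "'v gorder \<Rightarrow> 'w gorder \<Rightarrow> ('v \<Rightarrow> 'w) \<Rightarrow> bool" where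
  "order_iso P Q t \<longleftrightarrow> bij_betw t (carrier P) (carrier Q) \<and> eq Q = (=) \<and>
    (\<forall>x \<in> carrier P. \<forall>y \<in> carrier P. t x \<sqsubseteq>\<^bsub>Q\<^esub> t y \<longleftrightarrow> x \<sqsubseteq>\<^bsub>P\<^esub> y)"

lemma order_isoD:
  assumes "order_iso P Q t"
  shows "carrier Q = t ` carrier P" "eq Q = (=)" "inj_on t (carrier P)"
    "\<And>x y. x \<in> carrier P \<Longrightarrow> y \<in> carrier P \<Longrightarrow> t x \<sqsubseteq>\<^bsub>Q\<^esub> t y \<longleftrightarrow> x \<sqsubseteq>\<^bsub>P\<^esub> y"
  using assms unfolding order_iso_def bij_betw_def by auto

lemma order_iso_inv:
  assumes "order_iso P Q t" "eq P = (=)"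
  shows "order_iso Q P (inv_into (carrier P) t)"
  unfolding order_iso_def
proof (intro conjI ballI)
  note t = order_isoD[OF assms(1)]
  show "bij_betw (inv_into (carrier P) t) (carrier Q) (carrier P)"
    using assms(1) bij_betw_inv_into unfolding order_iso_def by blast
  show "eq P = (=)" by fact
  fix x y assume "x \<in> carrier Q" "y \<in> carrier Q"
  then show "inv_into (carrier P) t x \<sqsubseteq>\<^bsub>P\<^esub> inv_into (carrier P) t y \<longleftrightarrow> x \<sqsubseteq>\<^bsub>Q\<^esub> y"
    using t(1,3,4) by auto
qed

lemma order_iso_comp:
  assumes "order_iso P Q t" "order_iso Q R s"
  shows "order_iso P R (s \<circ> t)"
  unfolding order_iso_def
proof (intro conjI ballI)
  show "bij_betw (s \<circ> t) (carrier P) (carrier R)"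
    using assms bij_betw_trans unfolding order_iso_def by blast
qed (use order_isoD[OF assms(1)] order_isoD[OF assms(2)] in auto)

lemma order_iso_partial_order:
  assumes "partial_order P" "order_iso P Q t"
  shows "partial_order Q"
proof -
  interpret partial_order P by fact
  note t = order_isoD[OF assms(2)]
  show ?thesis
  proof (rule partial_orderI)
    show "eq Q = (=)" by (rule t)
    show "a = b" if "a \<in> carrier Q" "b \<in> carrier Q" "a \<sqsubseteq>\<^bsub>Q\<^esub> b" "b \<sqsubseteq>\<^bsub>Q\<^esub> a" for a b
      using that t(1,4) le_antisym by fastforce
  qed (use t(1,4) le_trans in auto)
qed

lemma order_iso_is_lub:
  assumes t: "order_iso P Q t" and "S \<subseteq> carrier P" "x \<in> carrier P"
  shows "is_lub Q (t x) (t ` S) \<longleftrightarrow> is_lub P x S"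
proof -
  have "S \<inter> carrier P = S" "t ` S \<inter> t ` carrier P = t ` S" using assms(2) by auto
  then show ?thesis
    using assms(2,3) order_isoD(4)[OF t] unfolding is_lub_iff order_isoD(1)[OF t]
    by (simp add: subset_iff)
qed

lemma order_iso_finite_join:
  assumes P: "finite_join P" and t: "order_iso P Q t"
  shows "finite_join Q"
  unfolding finite_join_def
proof (intro conjI allI impI)
  show "partial_order Q" using P t order_iso_partial_order unfolding finite_join_def by blast
  fix S assume "finite S \<and> S \<subseteq> carrier Q"
  then obtain T where T: "finite T" "T \<subseteq> carrier P" "S = t ` T"
    using finite_subset_image order_isoD(1)[OF t] by metis
  then obtain x where "is_lub P x T" using P unfolding finite_join_def by blast
  moreover from this have "x \<in> carrier P" by (simp add: is_lub_iff)
  ultimately show "\<exists>x. is_lub Q x S" using order_iso_is_lub[OF t T(2)] T(3) by blast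
qed

lemma FJ_HomD:
  assumes "f \<in> FJ_Hom P Q"
  shows "f \<in> extensional (carrier P)" "\<And>x. x \<in> carrier P \<Longrightarrow> f x \<in> carrier Q"
    "\<And>x y. x \<in> carrier P \<Longrightarrow> y \<in> carrier P \<Longrightarrow> x \<sqsubseteq>\<^bsub>P\<^esub> y \<Longrightarrow> f x \<sqsubseteq>\<^bsub>Q\<^esub> f y"
    "\<And>S x. finite S \<Longrightarrow> S \<subseteq> carrier P \<Longrightarrow> is_lub P x S \<Longrightarrow> is_lub Q (f x) (f ` S)"
  using assms unfolding FJ_Hom_def isotone_def by (auto simp: PiE_def)

lemma FJ_HomI:
  assumes "finite_join P" "finite_join Q" "f \<in> extensional (carrier P)"
    and "\<And>x. x \<in> carrier P \<Longrightarrow> f x \<in> carrier Q"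
    and "\<And>x y. x \<in> carrier P \<Longrightarrow> y \<in> carrier P \<Longrightarrow> x \<sqsubseteq>\<^bsub>P\<^esub> y \<Longrightarrow> f x \<sqsubseteq>\<^bsub>Q\<^esub> f y"
    and "\<And>S x. finite S \<Longrightarrow> S \<subseteq> carrier P \<Longrightarrow> is_lub P x S \<Longrightarrow> is_lub Q (f x) (f ` S)"
  shows "f \<in> FJ_Hom P Q"
  using assms unfolding FJ_Hom_def isotone_def finite_join_def partial_order_def
  by (auto simp: PiE_def)

lemma FJ_Par_simps [simp]:
  "Ob FJ_Par = {P. finite_join P}" "Hom FJ_Par = FJ_Hom"
  "Comp FJ_Par P Q R g f = compose (carrier P) g f" "Ident FJ_Par P = (\<lambda>x \<in> carrier P. x)"
  by (simp_all add: FJ_Par_def)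

lemma category_FJ_Par: "category FJ_Par"
proof
  fix P Q R :: "'v gorder" and f g
  assume ob: "P \<in> Ob FJ_Par" "Q \<in> Ob FJ_Par" "R \<in> Ob FJ_Par"
    and "f \<in> Hom FJ_Par P Q" and "g \<in> Hom FJ_Par Q R"
  then have f: "f \<in> FJ_Hom P Q" and g: "g \<in> FJ_Hom Q R" by simp_all
  show "Comp FJ_Par P Q R g f \<in> Hom FJ_Par P R"
    unfolding FJ_Par_simps
  proof (rule FJ_HomI)
    fix S x assume S: "finite S" "S \<subseteq> carrier P" "is_lub P x S"
    have "f ` S \<subseteq> carrier Q" using FJ_HomD(2)[OF f] S(2) by auto
    then have "is_lub R (g (f x)) (g ` (f ` S))"
      using S(1) FJ_HomD(4)[OF f S] by (intro FJ_HomD(4)[OF g]) auto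
    moreover have "x \<in> carrier P" using S(3) by (simp add: is_lub_iff)
    moreover have "compose (carrier P) g f ` S = g ` (f ` S)"
      using S(2) by (force simp: compose_def)
    ultimately show "is_lub R (compose (carrier P) g f x) (compose (carrier P) g f ` S)"
      by (simp add: compose_def)
  qed (use ob FJ_HomD(2,3)[OF f] FJ_HomD(2,3)[OF g] in \<open>auto simp: compose_def\<close>)
next
  fix P :: "'v gorder"
  assume "P \<in> Ob FJ_Par"
  then have P: "finite_join P" by simp
  show "Ident FJ_Par P \<in> Hom FJ_Par P P"
    unfolding FJ_Par_simps
  proof (rule FJ_HomI)
    fix S x assume S: "S \<subseteq> carrier P" "is_lub P x S"
    then have "(\<lambda>x\<in>carrier P. x) ` S = S" "x \<in> carrier P" by (force, simp add: is_lub_iff)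
    then show "is_lub P ((\<lambda>x\<in>carrier P. x) x) ((\<lambda>x\<in>carrier P. x) ` S)" using S by simp
  qed (use P in auto)
next
  fix P Q :: "'v gorder" and f
  assume "f \<in> Hom FJ_Par P Q"
  then have f: "f \<in> FJ_Hom P Q" by simp
  show "Comp FJ_Par P P Q f (Ident FJ_Par P) = f"
    using FJ_HomD(1)[OF f] by (auto simp: compose_def fun_eq_iff extensional_def)
  show "Comp FJ_Par P Q Q (Ident FJ_Par Q) f = f"
    using FJ_HomD(1,2)[OF f] by (auto simp: compose_def fun_eq_iff extensional_def)
next
  fix W P Q R :: "'v gorder" and f g h
  assume "f \<in> Hom FJ_Par W P"
  then have f: "f \<in> FJ_Hom W P" by simp
  show "Comp FJ_Par W Q R h (Comp FJ_Par W P Q g f) = Comp FJ_Par W P R (Comp FJ_Par P Q R h g) f"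
    using FJ_HomD(2)[OF f] by (auto simp: compose_def)
qed

text \<open>A map that corresponds to a join-preserving one under order isomorphisms of source and target
  is join-preserving itself, because lubs are determined by the order.\<close>

lemma FJ_Hom_conjugate:
  assumes f: "f \<in> FJ_Hom P Q" and P: "finite_join P" and Q: "finite_join Q"
    and t: "order_iso P P' t" and s: "order_iso Q Q' s"
    and ext: "f' \<in> extensional (carrier P')"
    and f': "\<And>x. x \<in> carrier P \<Longrightarrow> f' (t x) = s (f x)"
  shows "f' \<in> FJ_Hom P' Q'"
proof (rule FJ_HomI)
  show "finite_join P'" "finite_join Q'" using order_iso_finite_join P Q t s by blast+
  fix S y assume S: "finite S" "S \<subseteq> carrier P'" "is_lub P' y S"
  then obtain T x where T: "finite T" "T \<subseteq> carrier P" "S = t ` T" "x \<in> carrier P" "y = t x"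
    using finite_subset_image[of S t "carrier P"] order_isoD(1)[OF t] by (auto simp: is_lub_iff)
  have "is_lub P x T" using S(3) order_iso_is_lub[OF t T(2,4)] T(3,5) by simp
  then have "is_lub Q (f x) (f ` T)" using FJ_HomD(4)[OF f] T by blast
  moreover have "f ` T \<subseteq> carrier Q" "f x \<in> carrier Q" using FJ_HomD(2)[OF f] T by auto
  ultimately have "is_lub Q' (s (f x)) (s ` f ` T)" using order_iso_is_lub[OF s] by blast
  moreover have "s ` f ` T = f' ` S" unfolding T(3) image_image
    using T(2) f' by (intro image_cong) auto
  ultimately show "is_lub Q' (f' y) (f' ` S)" using f' T by simp
qed (use ext f' order_isoD[OF t] order_isoD[OF s] FJ_HomD(2,3)[OF f] in auto)

text \<open>The data \<open>G\<close> on the right is not yet known to be a functor, and it may take values in another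
  type than \<open>F\<close>, so that \<open>t\<close> cannot be called a natural isomorphism.\<close>

definition transport ::
    "('o, 'm) cat \<Rightarrow> ('o, 'm, 'v gorder, 'v \<Rightarrow> 'v) cfunctor \<Rightarrow> ('o \<Rightarrow> 'v \<Rightarrow> 'w) \<Rightarrow>
     ('o, 'm, 'w gorder, 'w \<Rightarrow> 'w) cfunctor \<Rightarrow> bool" where
  "transport C F t G \<longleftrightarrow>
    (\<forall>X \<in> Ob C. order_iso (FOb F X) (FOb G X) (t X)) \<and>
    (\<forall>X \<in> Ob C. \<forall>Y \<in> Ob C. \<forall>f \<in> Hom C X Y. FMor G X Y f \<in> extensional (carrier (FOb G X)) \<and>
      (\<forall>x \<in> carrier (FOb F X). FMor G X Y f (t X x) = t Y (FMor F X Y f x)))"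

lemma cat_functor_FJ_ParD:
  assumes "cat_functor C FJ_Par F" "X \<in> Ob C" "Y \<in> Ob C" "f \<in> Hom C X Y" "x \<in> carrier (FOb F X)"
  shows "FMor F X Y f x \<in> carrier (FOb F Y)"
proof -
  have "FMor F X Y f \<in> FJ_Hom (FOb F X) (FOb F Y)" using assms by (simp add: cat_functor_def)
  then show ?thesis using assms(5) by (rule FJ_HomD(2))
qed

text \<open>The square for \<open>f\<close> forces \<open>G f = t \<circ> F f \<circ> t\<inverse>\<close>, and conjugation by bijections respects
  identities and composition.\<close>

lemma cat_functor_transport:
  assumes F: "cat_functor C FJ_Par F" and G: "transport C F t G"
  shows "cat_functor C FJ_Par G"
  unfolding cat_functor_def
proof (intro conjI ballI)
  show "category C" "category FJ_Par" using F category_FJ_Par by (auto simp: cat_functor_def)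
next
  fix X assume X: "X \<in> Ob C"
  have FX: "finite_join (FOb F X)" and t: "order_iso (FOb F X) (FOb G X) (t X)"
    using F G X by (auto simp: cat_functor_def transport_def)
  then show "FOb G X \<in> Ob FJ_Par" using order_iso_finite_join by auto
  have i: "Ident C X \<in> Hom C X X"
    using F X by (auto simp: cat_functor_def category_def)
  have "FMor F X X (Ident C X) = Ident FJ_Par (FOb F X)"
    using F X by (auto simp: cat_functor_def)
  then have *: "FMor G X X (Ident C X) (t X x) = t X x" if "x \<in> carrier (FOb F X)" for x
    using G X i that by (auto simp: transport_def)
  show "FMor G X X (Ident C X) = Ident FJ_Par (FOb G X)"
    by (rule extensionalityI[of _ "carrier (FOb G X)"])
      (use G X i * order_isoD(1)[OF t] in \<open>auto simp: transport_def\<close>)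
next
  fix X Y f assume XY: "X \<in> Ob C" "Y \<in> Ob C" "f \<in> Hom C X Y"
  show "FMor G X Y f \<in> Hom FJ_Par (FOb G X) (FOb G Y)"
    unfolding FJ_Par_simps
    by (rule FJ_Hom_conjugate[where f = "FMor F X Y f"
      and P = "FOb F X" and Q = "FOb F Y" and t = "t X" and s = "t Y"])
      (use F G XY in \<open>auto simp: cat_functor_def transport_def\<close>)
next
  fix X Y Z f g
  assume ob: "X \<in> Ob C" "Y \<in> Ob C" "Z \<in> Ob C" and f: "f \<in> Hom C X Y" and g: "g \<in> Hom C Y Z"
  let ?gf = "Comp C X Y Z g f"
  have gf: "?gf \<in> Hom C X Z"
    using F ob f g category.comp_in_hom[of C X Y Z f g] by (simp add: cat_functor_def)
  have t: "order_iso (FOb F X) (FOb G X) (t X)" using G ob by (auto simp: transport_def)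
  have Ff: "FMor F X Y f x \<in> carrier (FOb F Y)" if "x \<in> carrier (FOb F X)" for x
    using cat_functor_FJ_ParD[OF F] ob f that by blast
  have "FMor F X Z ?gf = compose (carrier (FOb F X)) (FMor F Y Z g) (FMor F X Y f)"
    using F ob f g by (auto simp: cat_functor_def)
  then have *: "FMor G X Z ?gf (t X x) = FMor G Y Z g (FMor G X Y f (t X x))"
    if "x \<in> carrier (FOb F X)" for x
    using G ob f g gf Ff that by (auto simp: transport_def compose_def)
  show "FMor G X Z ?gf =
      Comp FJ_Par (FOb G X) (FOb G Y) (FOb G Z) (FMor G Y Z g) (FMor G X Y f)"
    by (rule extensionalityI[of _ "carrier (FOb G X)"])
      (use G ob gf * order_isoD(1)[OF t] in \<open>auto simp: transport_def compose_def\<close>)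
qed

lemma order_iso_is_iso:
  assumes P: "finite_join P" and t: "order_iso P Q t"
  shows "is_iso FJ_Par P Q (restrict t (carrier P))"
proof -
  have Q: "finite_join Q" using order_iso_finite_join[OF P t] .
  let ?s = "inv_into (carrier P) t"
  have eqP: "eq P = (=)" using P by (simp add: finite_join_def partial_order.eq_is_equal)
  have s: "order_iso Q P ?s" using order_iso_inv[OF t eqP] .
  have hom: "restrict u (carrier A) \<in> FJ_Hom A B"
    if A: "finite_join A" and B: "finite_join B" and u: "order_iso A B u"
    for A B :: "'a gorder" and u
  proof (rule FJ_HomI[OF A B])
    fix S x assume S: "S \<subseteq> carrier A" "is_lub A x S"
    then have x: "x \<in> carrier A" by (simp add: is_lub_iff)
    have "restrict u (carrier A) ` S = u ` S" using S by (intro image_cong) auto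
    then show "is_lub B (restrict u (carrier A) x) (restrict u (carrier A) ` S)"
      using order_iso_is_lub[OF u S(1) x] S x by simp
  qed (use order_isoD[OF u] in auto)
  note tD = order_isoD[OF t] and sD = order_isoD[OF s]
  show ?thesis
    unfolding is_iso_def
  proof (intro conjI bexI)
    show "restrict ?s (carrier Q) \<in> Hom FJ_Par Q P" using hom[OF Q P s] by simp
    show "restrict t (carrier P) \<in> Hom FJ_Par P Q" using hom[OF P Q t] by simp
    show "Comp FJ_Par P Q P (restrict ?s (carrier Q)) (restrict t (carrier P)) = Ident FJ_Par P"
      using tD by (auto simp: compose_def)
    show "Comp FJ_Par Q P Q (restrict t (carrier P)) (restrict ?s (carrier Q)) = Ident FJ_Par Q"
      using tD sD by (auto simp: compose_def f_inv_into_f intro!: restrict_ext)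
  qed
qed

text \<open>The natural isomorphism is \<open>s X \<circ> (t X)\<inverse>\<close>; pasting the two squares along \<open>F\<close> gives
  its naturality.\<close>

lemma transport_naturally_isomorphic:
  assumes F: "cat_functor C FJ_Par F" and G: "transport C F t G" and H: "transport C F s H"
  shows "naturally_isomorphic C FJ_Par G H"
proof -
  have GF: "cat_functor C FJ_Par G" and HF: "cat_functor C FJ_Par H"
    using cat_functor_transport F G H by blast+
  define v where "v X = s X \<circ> inv_into (carrier (FOb F X)) (t X)" for X
  have t: "order_iso (FOb F X) (FOb G X) (t X)" and s: "order_iso (FOb F X) (FOb H X) (s X)"
    if "X \<in> Ob C" for X using G H that by (auto simp: transport_def)
  have v: "order_iso (FOb G X) (FOb H X) (v X)" if X: "X \<in> Ob C" for X
  proof -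
    have "eq (FOb F X) = (=)"
      using F X by (auto simp: cat_functor_def finite_join_def partial_order.eq_is_equal)
    then show ?thesis unfolding v_def using order_iso_comp[OF order_iso_inv[OF t] s] X by blast
  qed
  have vt: "v X (t X x) = s X x" if "X \<in> Ob C" "x \<in> carrier (FOb F X)" for X x
    using order_isoD(3)[OF t] that by (simp add: v_def)
  define \<tau> where "\<tau> X = restrict (v X) (carrier (FOb G X))" for X
  show ?thesis
    unfolding naturally_isomorphic_def
  proof (intro conjI exI[of _ \<tau>] ballI GF HF)
    fix X assume X: "X \<in> Ob C"
    then have "finite_join (FOb G X)" using GF by (auto simp: cat_functor_def)
    then show "is_iso FJ_Par (FOb G X) (FOb H X) (\<tau> X)"
      unfolding \<tau>_def using order_iso_is_iso v X by blast
  next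
    fix X Y f assume XY: "X \<in> Ob C" "Y \<in> Ob C" "f \<in> Hom C X Y"
    have Ff: "FMor F X Y f x \<in> carrier (FOb F Y)" if "x \<in> carrier (FOb F X)" for x
      using cat_functor_FJ_ParD[OF F] XY that by blast
    have im: "t X x \<in> carrier (FOb G X)" if "X \<in> Ob C" "x \<in> carrier (FOb F X)" for X x
      using order_isoD(1)[OF t] that by blast
    have "\<tau> Y (FMor G X Y f y) = FMor H X Y f (\<tau> X y)" if y: "y \<in> carrier (FOb G X)" for y
    proof -
      obtain x where x: "x \<in> carrier (FOb F X)" "y = t X x"
        using y order_isoD(1)[OF t[OF XY(1)]] by blast
      have "FMor G X Y f y = t Y (FMor F X Y f x)" "FMor H X Y f (s X x) = s Y (FMor F X Y f x)"
        using G H XY x by (auto simp: transport_def)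
      then show ?thesis unfolding \<tau>_def using x XY Ff im vt by simp
    qed
    then show "Comp FJ_Par (FOb G X) (FOb G Y) (FOb H Y) (\<tau> Y) (FMor G X Y f) =
        Comp FJ_Par (FOb G X) (FOb H X) (FOb H Y) (FMor H X Y f) (\<tau> X)"
      by (auto simp: compose_def)
  qed
qed

lemma naturally_isomorphic_imp_isomorphic:
  assumes "naturally_isomorphic C D F G" and X: "X \<in> Ob C"
  shows "isomorphic D (FOb F X) (FOb G X)"
proof -
  have F: "cat_functor C D F" and G: "cat_functor C D G"
    using assms(1) by (simp_all add: naturally_isomorphic_def)
  have "\<exists>\<tau>. \<forall>X \<in> Ob C. is_iso D (FOb F X) (FOb G X) (\<tau> X)"
    using assms(1) unfolding naturally_isomorphic_def by meson
  moreover have "FOb F X \<in> Ob D" "FOb G X \<in> Ob D" using F G X by (simp_all add: cat_functor_def)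
  ultimately show ?thesis using X unfolding isomorphic_def by meson
qed

lemma order_iso_rename:
  assumes "inj i"
  shows "order_iso P (rename i P) i"
  using assms unfolding order_iso_def rename_def bij_betw_def
  by (auto simp: inj_on_def)

lemma transport_rename:
  assumes G: "transport C F t G" and i: "inj i"
    and H: "\<And>X. FOb H X = rename i (FOb G X)"
      "\<And>X Y f. FMor H X Y f = rename_map i (FOb G X) (FMor G X Y f)"
  shows "transport C F (\<lambda>X. i \<circ> t X) H"
  unfolding transport_def H
proof (intro conjI ballI)
  fix X assume "X \<in> Ob C"
  then have t: "order_iso (FOb F X) (FOb G X) (t X)" using G by (simp add: transport_def)
  show "order_iso (FOb F X) (rename i (FOb G X)) (i \<circ> t X)"
    using order_iso_comp[OF t order_iso_rename[OF i]] .
  fix Y f assume Y: "Y \<in> Ob C" "f \<in> Hom C X Y"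
  show "rename_map i (FOb G X) (FMor G X Y f) \<in> extensional (carrier (rename i (FOb G X)))"
    by (simp add: rename_map_def rename_def)
  fix x assume "x \<in> carrier (FOb F X)"
  then show "rename_map i (FOb G X) (FMor G X Y f) ((i \<circ> t X) x) = (i \<circ> t Y) (FMor F X Y f x)"
    using G Y \<open>X \<in> Ob C\<close> i order_isoD(1)[OF t] by (simp add: rename_map_def transport_def)
qed

section \<open>The calculus of controlled relations\<close>

abbreviation coarse_space :: "'a coarse \<Rightarrow> bool" where
  "coarse_space X \<equiv> coarse_structure (carrier X) (entourages X)"

lemma entourage_carrier: "coarse_space X \<Longrightarrow> E \<in> entourages X \<Longrightarrow> E \<subseteq> carrier X \<times> carrier X"
  and entourage_Id: "coarse_space X \<Longrightarrow> Id_on (carrier X) \<in> entourages X"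
  and entourage_comp:
    "coarse_space X \<Longrightarrow> E \<in> entourages X \<Longrightarrow> F \<in> entourages X \<Longrightarrow> E O F \<in> entourages X"
  and entourage_converse: "coarse_space X \<Longrightarrow> E \<in> entourages X \<Longrightarrow> E\<inverse> \<in> entourages X"
  and entourage_Union:
    "coarse_space X \<Longrightarrow> finite \<F> \<Longrightarrow> \<F> \<subseteq> entourages X \<Longrightarrow> \<Union>\<F> \<in> entourages X"
  and entourage_subset:
    "coarse_space X \<Longrightarrow> F \<in> entourages X \<Longrightarrow> E \<subseteq> F \<Longrightarrow> E \<in> entourages X"
  unfolding coarse_structure_def by auto

lemma entourage_Un:
  "coarse_space X \<Longrightarrow> E \<in> entourages X \<Longrightarrow> F \<in> entourages X \<Longrightarrow> E \<union> F \<in> entourages X"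
  using entourage_Union[of X "{E, F}"] by simp

lemma coarse_structureI:
  assumes "\<And>E. E \<in> \<E> \<Longrightarrow> E \<subseteq> X \<times> X" "Id_on X \<in> \<E>"
    and "\<And>E F. E \<in> \<E> \<Longrightarrow> F \<in> \<E> \<Longrightarrow> E O F \<in> \<E>"
    and "\<And>E. E \<in> \<E> \<Longrightarrow> E\<inverse> \<in> \<E>"
    and Un: "\<And>E F. E \<in> \<E> \<Longrightarrow> F \<in> \<E> \<Longrightarrow> E \<union> F \<in> \<E>"
    and sub: "\<And>E F. E \<in> \<E> \<Longrightarrow> F \<subseteq> E \<Longrightarrow> F \<in> \<E>"
  shows "coarse_structure X \<E>"
proof -
  have "\<Union>\<F> \<in> \<E>" if "finite \<F>" "\<F> \<subseteq> \<E>" for \<F>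
    using that
  proof (induction \<F>)
    case empty
    then show ?case using sub[OF assms(2)] by simp
  next
    case (insert E \<F>)
    then show ?case using Un by simp
  qed
  then show ?thesis unfolding coarse_structure_def using assms(1-4) sub by auto
qed

lemma CtrTotRelD:
  assumes "\<eta> \<in> CtrTotRel X Y"
  shows "\<eta> \<subseteq> carrier Y \<times> carrier X"
    "\<And>E. E \<in> entourages X \<Longrightarrow> \<eta> O E O \<eta>\<inverse> \<in> entourages Y"
    "\<And>x. x \<in> carrier X \<Longrightarrow> \<exists>y. (y, x) \<in> \<eta>"
  using assms unfolding CtrTotRel_def Ad_def by auto

lemma CtrTotRelI:
  assumes "\<eta> \<subseteq> carrier Y \<times> carrier X"
    "\<And>E. E \<in> entourages X \<Longrightarrow> \<eta> O E O \<eta>\<inverse> \<in> entourages Y"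
    "\<And>x. x \<in> carrier X \<Longrightarrow> \<exists>y. (y, x) \<in> \<eta>"
  shows "\<eta> \<in> CtrTotRel X Y"
  using assms unfolding CtrTotRel_def Ad_def by blast

lemma CtrTotRel_diag:
  assumes X: "coarse_space X" and \<eta>: "\<eta> \<in> CtrTotRel X Y"
  shows "\<eta> O \<eta>\<inverse> \<in> entourages Y"
proof -
  have "\<eta> O \<eta>\<inverse> = \<eta> O Id_on (carrier X) O \<eta>\<inverse>" using CtrTotRelD(1)[OF \<eta>] by blast
  then show ?thesis using CtrTotRelD(2)[OF \<eta> entourage_Id[OF X]] by simp
qed

lemma CtrTotRel_comp:
  assumes \<eta>: "\<eta> \<in> CtrTotRel X Y" and \<xi>: "\<xi> \<in> CtrTotRel Y Z"
  shows "\<xi> O \<eta> \<in> CtrTotRel X Z"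
proof (rule CtrTotRelI)
  show "\<xi> O \<eta> \<subseteq> carrier Z \<times> carrier X" using CtrTotRelD(1)[OF \<eta>] CtrTotRelD(1)[OF \<xi>] by blast
  fix E assume "E \<in> entourages X"
  then have "\<xi> O (\<eta> O E O \<eta>\<inverse>) O \<xi>\<inverse> \<in> entourages Z" using CtrTotRelD(2) \<eta> \<xi> by blast
  then show "(\<xi> O \<eta>) O E O (\<xi> O \<eta>)\<inverse> \<in> entourages Z" by (simp add: converse_relcomp O_assoc)
next
  fix x assume "x \<in> carrier X"
  then obtain y where y: "(y, x) \<in> \<eta>" using CtrTotRelD(3)[OF \<eta>] by blast
  then have "y \<in> carrier Y" using CtrTotRelD(1)[OF \<eta>] by blast
  then show "\<exists>z. (z, x) \<in> \<xi> O \<eta>" using CtrTotRelD(3)[OF \<xi>] y by blast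
qed

lemma CtrTotRel_Id:
  assumes "coarse_space X"
  shows "Id_on (carrier X) \<in> CtrTotRel X X"
proof (rule CtrTotRelI)
  fix E assume E: "E \<in> entourages X"
  then have "Id_on (carrier X) O E O (Id_on (carrier X))\<inverse> \<subseteq> E" by auto
  then show "Id_on (carrier X) O E O (Id_on (carrier X))\<inverse> \<in> entourages X"
    using entourage_subset[OF assms E] by blast
qed auto

text \<open>A total relation \<open>\<eta>2\<close> satisfies \<open>\<eta>1 \<subseteq> (\<eta>1 \<circ> \<eta>2\<dagger>) \<circ> \<eta>2\<close>, and conversely
  \<open>\<eta>1 \<subseteq> F \<circ> \<eta>2 \<circ> E\<close> bounds \<open>\<eta>1 \<circ> \<eta>2\<dagger>\<close> by \<open>F \<circ> Ad \<eta>2 E\<close>. So closeness is a statement about a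
  single relation on the target; as that relation is the converse of \<open>\<eta>2 \<circ> \<eta>1\<dagger>\<close>, one
  direction of \<open>\<prec>\<close> already implies the other.\<close>

lemma rel_prec_iff:
  assumes X: "coarse_space X" and Y: "coarse_space Y"
    and \<eta>1: "\<eta>1 \<in> CtrTotRel X Y" and \<eta>2: "\<eta>2 \<in> CtrTotRel X Y"
  shows "rel_prec X Y \<eta>1 \<eta>2 \<longleftrightarrow> \<eta>1 O \<eta>2\<inverse> \<in> entourages Y"
proof
  assume "rel_prec X Y \<eta>1 \<eta>2"
  then obtain E F where EF: "E \<in> entourages X" "F \<in> entourages Y" "\<eta>1 \<subseteq> F O \<eta>2 O E"
    unfolding rel_prec_def by blast
  have "\<eta>1 O \<eta>2\<inverse> \<subseteq> F O (\<eta>2 O E O \<eta>2\<inverse>)" using EF(3) by blast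
  then show "\<eta>1 O \<eta>2\<inverse> \<in> entourages Y"
    using entourage_subset[OF Y entourage_comp[OF Y EF(2) CtrTotRelD(2)[OF \<eta>2 EF(1)]]] by blast
next
  assume "\<eta>1 O \<eta>2\<inverse> \<in> entourages Y"
  moreover have "\<eta>1 \<subseteq> (\<eta>1 O \<eta>2\<inverse>) O \<eta>2 O Id_on (carrier X)"
  proof clarify
    fix y x assume yx: "(y, x) \<in> \<eta>1"
    then have "x \<in> carrier X" using CtrTotRelD(1)[OF \<eta>1] by blast
    then show "(y, x) \<in> (\<eta>1 O \<eta>2\<inverse>) O \<eta>2 O Id_on (carrier X)" using CtrTotRelD(3)[OF \<eta>2] yx by blast
  qed
  ultimately show "rel_prec X Y \<eta>1 \<eta>2" unfolding rel_prec_def using entourage_Id[OF X] by blast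
qed

lemma close_iff:
  assumes X: "coarse_space X" and Y: "coarse_space Y"
  shows "(\<eta>1, \<eta>2) \<in> close X Y \<longleftrightarrow>
    \<eta>1 \<in> CtrTotRel X Y \<and> \<eta>2 \<in> CtrTotRel X Y \<and> \<eta>1 O \<eta>2\<inverse> \<in> entourages Y"
proof -
  have "\<eta>2 O \<eta>1\<inverse> \<in> entourages Y" if "\<eta>1 O \<eta>2\<inverse> \<in> entourages Y"
    using entourage_converse[OF Y that] by (simp add: converse_relcomp)
  then show ?thesis unfolding close_def using rel_prec_iff[OF X Y] by auto
qed

lemma equiv_close:
  assumes X: "coarse_space X" and Y: "coarse_space Y"
  shows "equiv (CtrTotRel X Y) (close X Y)"
proof (rule equivI)
  show "close X Y \<subseteq> CtrTotRel X Y \<times> CtrTotRel X Y" by (auto simp: close_def)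
  show "refl_on (CtrTotRel X Y) (close X Y)"
    using CtrTotRel_diag[OF X] by (auto simp: refl_on_def close_iff[OF X Y])
  show "sym (close X Y)" by (auto simp: sym_def close_def)
  show "trans (close X Y)"
  proof (rule transI)
    fix a b c assume "(a, b) \<in> close X Y" "(b, c) \<in> close X Y"
    then have abc: "a \<in> CtrTotRel X Y" "b \<in> CtrTotRel X Y" "c \<in> CtrTotRel X Y"
      "a O b\<inverse> \<in> entourages Y" "b O c\<inverse> \<in> entourages Y"
      by (simp_all add: close_iff[OF X Y])
    have "a O c\<inverse> \<subseteq> (a O b\<inverse>) O (b O c\<inverse>)"
      using CtrTotRelD(1)[OF abc(1)] CtrTotRelD(3)[OF abc(2)] by blast
    then show "(a, c) \<in> close X Y"
      using abc entourage_subset[OF Y entourage_comp[OF Y abc(4,5)]]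
        by (simp add: close_iff[OF X Y])
  qed
qed

abbreviation mor :: "'a coarse \<Rightarrow> 'a coarse \<Rightarrow> ('a \<times> 'a) set \<Rightarrow> ('a \<times> 'a) set set" where
  "mor X Y \<eta> \<equiv> close X Y `` {\<eta>}"

lemma mor_eq_iff:
  assumes "coarse_space X" "coarse_space Y" "\<eta>1 \<in> CtrTotRel X Y" "\<eta>2 \<in> CtrTotRel X Y"
  shows "mor X Y \<eta>1 = mor X Y \<eta>2 \<longleftrightarrow> \<eta>1 O \<eta>2\<inverse> \<in> entourages Y"
  using eq_equiv_class_iff[OF equiv_close[OF assms(1,2)] assms(3,4)] assms
  by (simp add: close_iff)

lemma mor_self: 
  assumes "coarse_space X" "coarse_space Y" "\<eta> \<in> CtrTotRel X Y"
  shows "\<eta> \<in> mor X Y \<eta>"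
  using equiv_class_self[OF equiv_close[OF assms(1,2)] assms(3)] .

lemma Coarse_simps:
  "X \<in> Ob (Coarse U) \<longleftrightarrow> carrier X \<in> U \<and> coarse_space X"
  "Hom (Coarse U) X Y = CtrTotRel X Y // close X Y"
  "Ident (Coarse U) X = mor X X (Id_on (carrier X))"
  by (simp_all add: Coarse_def)

lemma Coarse_HomE:
  assumes "f \<in> Hom (Coarse U) X Y"
  obtains \<eta> where "\<eta> \<in> CtrTotRel X Y" "f = mor X Y \<eta>"
  using assms by (auto simp: Coarse_simps elim: quotientE)

lemma mor_in_Hom: "\<eta> \<in> CtrTotRel X Y \<Longrightarrow> mor X Y \<eta> \<in> Hom (Coarse U) X Y"
  by (simp add: Coarse_simps quotientI)

text \<open>Composition respects closeness because a total controlled \<open>\<xi>\<close> can be moved past an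
  entourage of its source: \<open>\<xi> \<circ> F \<subseteq> Ad \<xi> F \<circ> \<xi>\<close>.\<close>

lemma Comp_mor:
  assumes X: "coarse_space X" and Y: "coarse_space Y" and Z: "coarse_space Z"
    and \<eta>: "\<eta> \<in> CtrTotRel X Y" and \<xi>: "\<xi> \<in> CtrTotRel Y Z"
  shows "Comp (Coarse U) X Y Z (mor Y Z \<xi>) (mor X Y \<eta>) = mor X Z (\<xi> O \<eta>)"
proof -
  have "mor X Z (\<xi>' O \<eta>') = mor X Z (\<xi> O \<eta>)"
    if that: "\<xi>' \<in> mor Y Z \<xi>" "\<eta>' \<in> mor X Y \<eta>" for \<xi>' \<eta>'
  proof -
    have c: "\<xi>' \<in> CtrTotRel Y Z" "\<eta>' \<in> CtrTotRel X Y"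
      and F: "\<eta> O \<eta>'\<inverse> \<in> entourages Y" and G: "\<xi> O \<xi>'\<inverse> \<in> entourages Z"
      using that by (auto simp: close_iff X Y Z)
    have "(\<xi> O \<eta>) O (\<xi>' O \<eta>')\<inverse> \<subseteq> (\<xi> O (\<eta> O \<eta>'\<inverse>) O \<xi>\<inverse>) O (\<xi> O \<xi>'\<inverse>)"
    proof clarsimp
      fix z y x y' z'
      assume a: "(z, y) \<in> \<xi>" "(y, x) \<in> \<eta>" "(z', y') \<in> \<xi>'" "(y', x) \<in> \<eta>'"
      obtain w where "(w, y') \<in> \<xi>"
        using a(3) CtrTotRelD(1)[OF c(1)] CtrTotRelD(3)[OF \<xi>] by blast
      then show "(z, z') \<in> (\<xi> O (\<eta> O \<eta>'\<inverse>) O \<xi>\<inverse>) O \<xi> O \<xi>'\<inverse>" using a by blast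
    qed
    then have "(\<xi> O \<eta>) O (\<xi>' O \<eta>')\<inverse> \<in> entourages Z"
      using entourage_subset[OF Z entourage_comp[OF Z CtrTotRelD(2)[OF \<xi> F] G]] by blast
    then show ?thesis
      using mor_eq_iff[OF X Z CtrTotRel_comp[OF \<eta> \<xi>] CtrTotRel_comp[OF c(2,1)]] by simp
  qed
  then have "Comp (Coarse U) X Y Z (mor Y Z \<xi>) (mor X Y \<eta>) =
      (\<Union>\<xi>' \<in> mor Y Z \<xi>. \<Union>\<eta>' \<in> mor X Y \<eta>. mor X Z (\<xi> O \<eta>))"
    by (simp add: Coarse_def)
  then show ?thesis using mor_self[OF X Y \<eta>] mor_self[OF Y Z \<xi>] by auto
qed

lemma category_Coarse: "category (Coarse U)"
proof
  fix X Y Z f g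
  assume ob: "X \<in> Ob (Coarse U)" "Y \<in> Ob (Coarse U)" "Z \<in> Ob (Coarse U)"
    and f: "f \<in> Hom (Coarse U) X Y" and g: "g \<in> Hom (Coarse U) Y Z"
  obtain \<eta> \<xi> where "\<eta> \<in> CtrTotRel X Y" "f = mor X Y \<eta>" "\<xi> \<in> CtrTotRel Y Z" "g = mor Y Z \<xi>"
    using f g by (auto elim!: Coarse_HomE)
  then show "Comp (Coarse U) X Y Z g f \<in> Hom (Coarse U) X Z"
    using ob by (simp add: Comp_mor Coarse_simps(1) mor_in_Hom CtrTotRel_comp)
next
  fix X assume "X \<in> Ob (Coarse U)"
  then show "Ident (Coarse U) X \<in> Hom (Coarse U) X X"
    unfolding Coarse_simps(3) by (intro mor_in_Hom CtrTotRel_Id) (simp add: Coarse_simps)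
next
  fix X Y f
  assume ob: "X \<in> Ob (Coarse U)" "Y \<in> Ob (Coarse U)" and f: "f \<in> Hom (Coarse U) X Y"
  obtain \<eta> where \<eta>: "\<eta> \<in> CtrTotRel X Y" "f = mor X Y \<eta>" using f by (rule Coarse_HomE)
  have "\<eta> O Id_on (carrier X) = \<eta>" "Id_on (carrier Y) O \<eta> = \<eta>"
    using CtrTotRelD(1)[OF \<eta>(1)] by auto
  then show "Comp (Coarse U) X X Y f (Ident (Coarse U) X) = f"
    "Comp (Coarse U) X Y Y (Ident (Coarse U) Y) f = f"
    using ob \<eta> by (simp_all add: Comp_mor Coarse_simps(1,3) CtrTotRel_Id)
next
  fix W X Y Z f g h
  assume ob: "W \<in> Ob (Coarse U)" "X \<in> Ob (Coarse U)" "Y \<in> Ob (Coarse U)" "Z \<in> Ob (Coarse U)"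
    and f: "f \<in> Hom (Coarse U) W X" and g: "g \<in> Hom (Coarse U) X Y" and h: "h \<in> Hom (Coarse U) Y Z"
  obtain \<eta> \<xi> \<zeta> where "\<eta> \<in> CtrTotRel W X" "f = mor W X \<eta>" "\<xi> \<in> CtrTotRel X Y" "g = mor X Y \<xi>"
    "\<zeta> \<in> CtrTotRel Y Z" "h = mor Y Z \<zeta>"
    using f g h by (auto elim!: Coarse_HomE)
  then show "Comp (Coarse U) W Y Z h (Comp (Coarse U) W X Y g f) =
      Comp (Coarse U) W X Z (Comp (Coarse U) X Y Z h g) f"
    using ob by (simp add: Comp_mor Coarse_simps(1) CtrTotRel_comp O_assoc)
qed

section \<open>Monomorphisms and epimorphisms of coarse spaces\<close>

definition coarse_embedding :: "'a coarse \<Rightarrow> 'a coarse \<Rightarrow> ('a \<times> 'a) set \<Rightarrow> bool" where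
  "coarse_embedding X Y \<eta> \<longleftrightarrow> (\<forall>F \<in> entourages Y. \<eta>\<inverse> O F O \<eta> \<in> entourages X)"

lemma set_universeD:
  assumes "set_universe U"
  shows "\<exists>N \<in> U. infinite N" "\<And>A B. A \<in> U \<Longrightarrow> B \<subseteq> A \<Longrightarrow> B \<in> U"
    "\<And>A B. A \<in> U \<Longrightarrow> B \<in> U \<Longrightarrow> \<exists>P \<in> U. P \<approx> A \<times> B"
  using assms unfolding set_universe_def by simp_all

lemma coarse_structure_discrete: "coarse_structure A (Pow (Id_on A))"
  by (rule coarse_structureI) (simp_all, blast+)

text \<open>An entourage \<open>F\<close> of \<open>Y\<close> pulls back to \<open>E = \<eta>\<dagger> \<circ> F \<circ> \<eta>\<close>. On a discrete space with one point
  for each pair in \<open>E\<close>, the two projections \<open>g\<close> and \<open>h\<close> to \<open>X\<close> are controlled and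
  \<open>g \<circ> h\<dagger> = E\<close>, so they are close iff \<open>E\<close> is an entourage; after composition with \<open>\<eta>\<close> they are
  always close. Conversely, when \<open>E\<close> is an entourage for every \<open>F\<close>, closeness of \<open>\<eta> \<circ> g\<close> and
  \<open>\<eta> \<circ> h\<close> pulls back to closeness of \<open>g\<close> and \<open>h\<close>.\<close>

lemma monic_mor_iff:
  assumes U: "set_universe U" and X: "X \<in> Ob (Coarse U)" and Y: "Y \<in> Ob (Coarse U)"
    and \<eta>: "\<eta> \<in> CtrTotRel X Y"
  shows "monic (Coarse U) X Y (mor X Y \<eta>) \<longleftrightarrow> coarse_embedding X Y \<eta>"
proof
  have Xc: "coarse_space X" and XU: "carrier X \<in> U" and Yc: "coarse_space Y"
    using X Y by (auto simp: Coarse_simps)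
  assume mono: "monic (Coarse U) X Y (mor X Y \<eta>)"
  show "coarse_embedding X Y \<eta>"
    unfolding coarse_embedding_def
  proof
    fix F assume F: "F \<in> entourages Y"
    define E where "E = \<eta>\<inverse> O F O \<eta>"
    obtain P where P: "P \<in> U" "P \<approx> carrier X \<times> carrier X"
      using set_universeD(3)[OF U XU XU] by blast
    obtain b where b: "bij_betw b P (carrier X \<times> carrier X)" using P(2) by (auto simp: eqpoll_def)
    define W0 where "W0 = {w \<in> P. b w \<in> E}"
    define W where "W = \<lparr>carrier = W0, entourages = Pow (Id_on W0)\<rparr>"
    have Wc: "coarse_space W" by (simp add: W_def coarse_structure_discrete)
    have "W0 \<in> U" using set_universeD(2)[OF U P(1)] unfolding W0_def by simp
    then have WOb: "W \<in> Ob (Coarse U)" using Wc by (simp add: Coarse_simps) (simp add: W_def)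
    have EX: "E \<subseteq> carrier X \<times> carrier X" using CtrTotRelD(1)[OF \<eta>] unfolding E_def by blast
    define g where "g = {(fst (b w), w) | w. w \<in> W0}"
    define h where "h = {(snd (b w), w) | w. w \<in> W0}"
    have ctr: "{(k w, w) | w. w \<in> W0} \<in> CtrTotRel W X" if k: "k ` W0 \<subseteq> carrier X" for k
    proof (rule CtrTotRelI)
      fix D assume "D \<in> entourages W"
      then have "{(k w, w) | w. w \<in> W0} O D O {(k w, w) | w. w \<in> W0}\<inverse> \<subseteq> Id_on (carrier X)"
        using k by (auto simp: W_def)
      then show "{(k w, w) | w. w \<in> W0} O D O {(k w, w) | w. w \<in> W0}\<inverse> \<in> entourages X"
        using entourage_subset[OF Xc entourage_Id[OF Xc]] by blast
    qed (use k in \<open>auto simp: W_def\<close>)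
    have gh: "g \<in> CtrTotRel W X" "h \<in> CtrTotRel W X"
      unfolding g_def h_def using EX by (force intro!: ctr simp: W0_def)+
    have bE: "\<exists>w \<in> W0. b w = e" if "e \<in> E" for e
      using that b EX unfolding W0_def bij_betw_def
        by (metis (mono_tags, lifting) imageE mem_Collect_eq subsetD)
    have ghE: "g O h\<inverse> = E"
    proof
      show "g O h\<inverse> \<subseteq> E" by (auto simp: g_def h_def W0_def)
      show "E \<subseteq> g O h\<inverse>"
      proof clarify
        fix x y assume "(x, y) \<in> E"
        then obtain w where "w \<in> W0" "b w = (x, y)" using bE by blast
        then have "(x, w) \<in> g" "(w, y) \<in> h\<inverse>" unfolding g_def h_def by force+
        then show "(x, y) \<in> g O h\<inverse>" by blast
      qed
    qed
    have "(\<eta> O g) O (\<eta> O h)\<inverse> = (\<eta> O \<eta>\<inverse>) O F O (\<eta> O \<eta>\<inverse>)"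
      using ghE unfolding E_def by (metis O_assoc converse_relcomp)
    also have "\<dots> \<in> entourages Y"
      using entourage_comp[OF Yc] CtrTotRel_diag[OF Xc \<eta>] F by blast
    finally have "mor W Y (\<eta> O g) = mor W Y (\<eta> O h)"
      using mor_eq_iff[OF Wc Yc] CtrTotRel_comp \<eta> gh by blast
    then have "mor W X g = mor W X h"
      using mono WOb gh \<eta> Wc Xc Yc unfolding monic_def
      by (simp add: Comp_mor mor_in_Hom)
    then show "\<eta>\<inverse> O F O \<eta> \<in> entourages X"
      using mor_eq_iff[OF Wc Xc gh] ghE E_def by simp
  qed
next
  have Xc: "coarse_space X" and Yc: "coarse_space Y" using X Y by (auto simp: Coarse_simps)
  assume emb: "coarse_embedding X Y \<eta>"
  show "monic (Coarse U) X Y (mor X Y \<eta>)"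
    unfolding monic_def
  proof (intro conjI ballI impI)
    show "mor X Y \<eta> \<in> Hom (Coarse U) X Y" using \<eta> by (rule mor_in_Hom)
    fix W g' h'
    assume W: "W \<in> Ob (Coarse U)" and hom: "g' \<in> Hom (Coarse U) W X" "h' \<in> Hom (Coarse U) W X"
      and eq: "Comp (Coarse U) W X Y (mor X Y \<eta>) g' = Comp (Coarse U) W X Y (mor X Y \<eta>) h'"
    have Wc: "coarse_space W" using W by (simp add: Coarse_simps)
    obtain g where g: "g \<in> CtrTotRel W X" "g' = mor W X g" using hom(1) by (rule Coarse_HomE)
    obtain h where h: "h \<in> CtrTotRel W X" "h' = mor W X h" using hom(2) by (rule Coarse_HomE)
    have "mor W Y (\<eta> O g) = mor W Y (\<eta> O h)" using eq by (simp add: g h Comp_mor Wc Xc Yc \<eta>)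
    then have "(\<eta> O g) O (\<eta> O h)\<inverse> \<in> entourages Y"
      using mor_eq_iff[OF Wc Yc] CtrTotRel_comp g(1) h(1) \<eta> by blast
    then have "\<eta>\<inverse> O ((\<eta> O g) O (\<eta> O h)\<inverse>) O \<eta> \<in> entourages X"
      using emb by (simp add: coarse_embedding_def)
    moreover have "g O h\<inverse> \<subseteq> \<eta>\<inverse> O ((\<eta> O g) O (\<eta> O h)\<inverse>) O \<eta>"
    proof clarify
      fix x x' w assume a: "(x, w) \<in> g" "(x', w) \<in> h"
      then obtain y y' where "(y, x) \<in> \<eta>" "(y', x') \<in> \<eta>"
        using CtrTotRelD(1)[OF g(1)] CtrTotRelD(1)[OF h(1)] CtrTotRelD(3)[OF \<eta>] by blast
      then show "(x, x') \<in> \<eta>\<inverse> O ((\<eta> O g) O (\<eta> O h)\<inverse>) O \<eta>" using a by blast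
    qed
    ultimately have "g O h\<inverse> \<in> entourages X" using entourage_subset[OF Xc] by blast
    then show "g' = h'" using mor_eq_iff[OF Wc Xc g(1) h(1)] g h by simp
  qed
qed

lemma rel_imageI: "s \<in> S \<Longrightarrow> (y, s) \<in> R \<Longrightarrow> y \<in> rel_image R S"
  unfolding rel_image_def by blast

lemma rel_image_comp: "rel_image (R O S) A = rel_image R (rel_image S A)"
  unfolding rel_image_def by blast

lemma rel_image_Un: "rel_image (R \<union> S) A = rel_image R A \<union> rel_image S A"
  unfolding rel_image_def by blast

text \<open>Points of \<open>P\<close> lie over \<open>Y\<close> via \<open>p\<close> and in one of two sheets according to \<open>c\<close>. Entourages are
  relations that are controlled in \<open>Y\<close> and change sheets only uniformly close to \<open>S\<close>: the sheets
  are glued along \<open>S\<close>. As the two sheets have to be realised inside a given universe, \<open>P\<close> is left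
  abstract instead of being a product.\<close>

definition doubling :: "'a coarse \<Rightarrow> 'a set \<Rightarrow> 'a set \<Rightarrow> ('a \<Rightarrow> 'a) \<Rightarrow> ('a \<Rightarrow> bool) \<Rightarrow> 'a coarse"
  where "doubling Y S P p c = \<lparr>carrier = P,
    entourages = {G. G \<subseteq> P \<times> P \<and> map_prod p p ` G \<in> entourages Y \<and>
      (\<exists>F \<in> entourages Y. \<forall>(u, v) \<in> G. c u \<noteq> c v \<longrightarrow> p u \<in> rel_image F S)}\<rparr>"

text \<open>If \<open>(u, w)\<close> is composed of \<open>(u, v)\<close> and \<open>(v, w)\<close> and changes sheets, then one of the two steps
  does. If it is the first, \<open>u\<close> is near \<open>S\<close> by assumption; if only the second, \<open>v\<close> is near \<open>S\<close> and
  \<open>u\<close> is near \<open>v\<close>.\<close>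

lemma coarse_space_doubling:
  assumes Y: "coarse_space Y" and p: "p ` P \<subseteq> carrier Y"
  shows "coarse_space (doubling Y S P p c)"
  unfolding doubling_def coarse.simps partial_object.simps
proof (rule coarse_structureI)
  let ?E = "{G. G \<subseteq> P \<times> P \<and> map_prod p p ` G \<in> entourages Y \<and>
      (\<exists>F \<in> entourages Y. \<forall>(u, v) \<in> G. c u \<noteq> c v \<longrightarrow> p u \<in> rel_image F S)}"
  note cl = entourage_subset[OF Y] entourage_comp[OF Y] entourage_converse[OF Y] entourage_Un[OF Y]
  have "map_prod p p ` Id_on P \<subseteq> Id_on (carrier Y)" using p by auto
  then show "Id_on P \<in> ?E" using cl(1)[OF entourage_Id[OF Y]] entourage_Id[OF Y] by auto
  fix E assume "E \<in> ?E"
  then obtain F where E: "E \<subseteq> P \<times> P" "map_prod p p ` E \<in> entourages Y" "F \<in> entourages Y"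
    "\<And>u v. (u, v) \<in> E \<Longrightarrow> c u \<noteq> c v \<Longrightarrow> p u \<in> rel_image F S" by blast
  show "E \<subseteq> P \<times> P" by (rule E(1))
  have "map_prod p p ` (E\<inverse>) = (map_prod p p ` E)\<inverse>" by force
  then have m: "map_prod p p ` (E\<inverse>) \<in> entourages Y" using cl(3)[OF E(2)] by simp
  moreover have "p v \<in> rel_image ((map_prod p p ` (E\<inverse>)) O F) S" if "(u, v) \<in> E" "c u \<noteq> c v" for u v
  proof -
    have "(p v, p u) \<in> map_prod p p ` (E\<inverse>)" using that by force
    moreover have "p u \<in> rel_image F S" using E(4) that by blast
    ultimately show ?thesis unfolding rel_image_comp by (rule rel_imageI[rotated])
  qed
  then have "\<forall>(u, v) \<in> E\<inverse>. c u \<noteq> c v \<longrightarrow> p u \<in> rel_image ((map_prod p p ` (E\<inverse>)) O F) S" by auto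
  ultimately show "E\<inverse> \<in> ?E" using cl(2)[OF m E(3)] E(1) by blast
  {
    fix F' assume "F' \<subseteq> E"
    then show "F' \<in> ?E" using E cl(1)[OF E(2) image_mono] by blast
  }
  fix E' assume "E' \<in> ?E"
  then obtain F' where E': "E' \<subseteq> P \<times> P" "map_prod p p ` E' \<in> entourages Y" "F' \<in> entourages Y"
    "\<And>u v. (u, v) \<in> E' \<Longrightarrow> c u \<noteq> c v \<Longrightarrow> p u \<in> rel_image F' S" by blast
  have "\<forall>(u, v) \<in> E \<union> E'. c u \<noteq> c v \<longrightarrow> p u \<in> rel_image (F \<union> F') S"
    using E(4) E'(4) by (auto simp: rel_image_Un)
  then show "E \<union> E' \<in> ?E"
    using E E' cl(4)[OF E(2) E'(2)] cl(4)[OF E(3) E'(3)] by (auto simp: image_Un)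
  let ?F = "F \<union> (map_prod p p ` E) O F'"
  have "p u \<in> rel_image ?F S" if uv: "(u, v) \<in> E" "(v, w) \<in> E'" "c u \<noteq> c w" for u v w
  proof (cases "c u = c v")
    case True
    have "(p u, p v) \<in> map_prod p p ` E" using uv(1) by force
    moreover have "p v \<in> rel_image F' S" using E'(4)[OF uv(2)] True uv(3) by simp
    ultimately have "p u \<in> rel_image (map_prod p p ` E O F') S"
      unfolding rel_image_comp by (rule rel_imageI[rotated])
    then show ?thesis by (simp add: rel_image_Un)
  next
    case False
    then show ?thesis using E(4)[OF uv(1)] by (simp add: rel_image_Un)
  qed
  then have "\<forall>(u, v) \<in> E O E'. c u \<noteq> c v \<longrightarrow> p u \<in> rel_image ?F S" by blast
  moreover have "map_prod p p ` (E O E') \<subseteq> (map_prod p p ` E) O (map_prod p p ` E')" by force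
  then have "map_prod p p ` (E O E') \<in> entourages Y" using cl(1)[OF cl(2)[OF E(2) E'(2)]] by blast
  moreover have "?F \<in> entourages Y" using cl(4)[OF E(3) cl(2)[OF E(2) E'(3)]] .
  moreover have "E O E' \<subseteq> P \<times> P" using E(1) E'(1) by blast
  ultimately show "E O E' \<in> ?E" by blast
qed

text \<open>The two sections of the doubling of \<open>Y\<close> along the range of \<open>\<eta>\<close> become close after
  composition with \<open>\<eta>\<close>. If \<open>\<eta>\<close> is epic they are close on all of \<open>Y\<close>, which says that every point
  of \<open>Y\<close> is uniformly close to the range. Conversely, morphisms that are close on a uniformly dense
  set are close.\<close>

lemma epic_mor_iff:
  assumes U: "set_universe U" and X: "X \<in> Ob (Coarse U)" and Y: "Y \<in> Ob (Coarse U)"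
    and \<eta>: "\<eta> \<in> CtrTotRel X Y"
  shows "epic (Coarse U) X Y (mor X Y \<eta>) \<longleftrightarrow> set_prec Y (carrier Y) (Domain \<eta>)"
proof
  have Xc: "coarse_space X" and YU: "carrier Y \<in> U" and Yc: "coarse_space Y"
    using X Y by (auto simp: Coarse_simps)
  assume epi: "epic (Coarse U) X Y (mor X Y \<eta>)"
  define S where "S = Domain \<eta>"
  \<comment> \<open>\<open>P\<close> has a point over \<open>y\<close> for every label in \<open>N\<close>; one sheet consists of the points labelled
    \<open>a\<close>, the other of all remaining ones.\<close>
  obtain N where N: "N \<in> U" "infinite N" using set_universeD(1)[OF U] by blast
  obtain P where P: "P \<in> U" "P \<approx> carrier Y \<times> N" using set_universeD(3)[OF U YU N(1)] by blast
  obtain q where q: "bij_betw q P (carrier Y \<times> N)" using P(2) by (auto simp: eqpoll_def)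
  obtain a b where ab: "a \<in> N" "b \<in> N" "a \<noteq> b"
    using infinite_arbitrarily_large[OF N(2), of 2] by (auto simp: card_2_iff)
  define p where "p = fst \<circ> q"
  define c where "c u \<longleftrightarrow> snd (q u) = a" for u
  have p: "p ` P \<subseteq> carrier Y"
    using bij_betw_apply[OF q] unfolding p_def by (auto simp: mem_Times_iff)
  have lift: "\<exists>u \<in> P. p u = y \<and> c u = i" if "y \<in> carrier Y" for y i
  proof -
    have "(y, if i then a else b) \<in> q ` P" using q ab that unfolding bij_betw_def by auto
    then obtain u where "u \<in> P" "q u = (y, if i then a else b)" by auto
    then show ?thesis using ab(3) unfolding p_def c_def by (intro bexI[of _ u]) auto
  qed
  define W where "W = doubling Y S P p c"
  have Wc: "coarse_space W" unfolding W_def using coarse_space_doubling[OF Yc p] .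
  have Wcar: "carrier W = P" by (simp add: W_def doubling_def)
  have WOb: "W \<in> Ob (Coarse U)" using Wc P(1) Wcar by (simp add: Coarse_simps)
  have WE: "G \<in> entourages W \<longleftrightarrow> G \<subseteq> P \<times> P \<and> map_prod p p ` G \<in> entourages Y \<and>
      (\<exists>F \<in> entourages Y. \<forall>(u, v) \<in> G. c u \<noteq> c v \<longrightarrow> p u \<in> rel_image F S)" for G
    by (simp add: W_def doubling_def)
  define j where "j i = {(u, y). u \<in> P \<and> c u = i \<and> p u = y}" for i
  have j: "j i \<in> CtrTotRel Y W" for i
  proof (rule CtrTotRelI)
    show "j i \<subseteq> carrier W \<times> carrier Y" using p unfolding j_def Wcar by auto
    show "\<exists>u. (u, y) \<in> j i" if "y \<in> carrier Y" for y using lift[OF that] unfolding j_def by blast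
    fix E assume E: "E \<in> entourages Y"
    have "map_prod p p ` (j i O E O (j i)\<inverse>) \<subseteq> E" unfolding j_def by auto
    then show "j i O E O (j i)\<inverse> \<in> entourages W"
      unfolding WE using entourage_subset[OF Yc E] E by (fastforce simp: j_def)
  qed
  have "(j True O \<eta>) O (j False O \<eta>)\<inverse> \<in> entourages W"
    unfolding WE
  proof (intro conjI bexI)
    show "(j True O \<eta>) O (j False O \<eta>)\<inverse> \<subseteq> P \<times> P" unfolding j_def by auto
    have "map_prod p p ` ((j True O \<eta>) O (j False O \<eta>)\<inverse>) \<subseteq> \<eta> O \<eta>\<inverse>" unfolding j_def by auto
    then show "map_prod p p ` ((j True O \<eta>) O (j False O \<eta>)\<inverse>) \<in> entourages Y"
      using entourage_subset[OF Yc CtrTotRel_diag[OF Xc \<eta>]] by blast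
    show "Id_on (carrier Y) \<in> entourages Y" using entourage_Id[OF Yc] .
    show "\<forall>(u, v) \<in> (j True O \<eta>) O (j False O \<eta>)\<inverse>. c u \<noteq> c v \<longrightarrow> p u \<in> rel_image (Id_on (carrier Y)) S"
      using CtrTotRelD(1)[OF \<eta>] unfolding j_def S_def rel_image_def by blast
  qed
  then have "mor X W (j True O \<eta>) = mor X W (j False O \<eta>)"
    using mor_eq_iff[OF Xc Wc] CtrTotRel_comp[OF \<eta> j] by blast
  then have "mor Y W (j True) = mor Y W (j False)"
    using epi WOb j \<eta> Wc Xc Yc unfolding epic_def by (simp add: Comp_mor mor_in_Hom)
  then have "j True O (j False)\<inverse> \<in> entourages W" using mor_eq_iff[OF Yc Wc j j] by simp
  then obtain F where F: "F \<in> entourages Y"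
    "\<And>u v. (u, v) \<in> j True O (j False)\<inverse> \<Longrightarrow> c u \<noteq> c v \<Longrightarrow> p u \<in> rel_image F S"
    unfolding WE by blast
  have "y \<in> rel_image F S" if y: "y \<in> carrier Y" for y
  proof -
    obtain u v where uv: "u \<in> P" "p u = y" "c u" "v \<in> P" "p v = y" "\<not> c v"
      using lift[OF y, of True] lift[OF y, of False] by auto
    then have "(u, v) \<in> j True O (j False)\<inverse>" unfolding j_def by auto
    then show ?thesis using F(2) uv by blast
  qed
  then show "set_prec Y (carrier Y) (Domain \<eta>)" unfolding set_prec_def using F(1) S_def by blast
next
  have Xc: "coarse_space X" and Yc: "coarse_space Y" using X Y by (auto simp: Coarse_simps)
  assume "set_prec Y (carrier Y) (Domain \<eta>)"
  then obtain F where F: "F \<in> entourages Y" "carrier Y \<subseteq> rel_image F (Domain \<eta>)"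
    unfolding set_prec_def by blast
  show "epic (Coarse U) X Y (mor X Y \<eta>)"
    unfolding epic_def
  proof (intro conjI ballI impI)
    show "mor X Y \<eta> \<in> Hom (Coarse U) X Y" using \<eta> by (rule mor_in_Hom)
    fix W g' h'
    assume W: "W \<in> Ob (Coarse U)" and hom: "g' \<in> Hom (Coarse U) Y W" "h' \<in> Hom (Coarse U) Y W"
      and eq: "Comp (Coarse U) X Y W g' (mor X Y \<eta>) = Comp (Coarse U) X Y W h' (mor X Y \<eta>)"
    have Wc: "coarse_space W" using W by (simp add: Coarse_simps)
    obtain g where g: "g \<in> CtrTotRel Y W" "g' = mor Y W g" using hom(1) by (rule Coarse_HomE)
    obtain h where h: "h \<in> CtrTotRel Y W" "h' = mor Y W h" using hom(2) by (rule Coarse_HomE)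
    have "mor X W (g O \<eta>) = mor X W (h O \<eta>)" using eq by (simp add: g h Comp_mor Wc Xc Yc \<eta>)
    then have K: "(g O \<eta>) O (h O \<eta>)\<inverse> \<in> entourages W"
      using mor_eq_iff[OF Xc Wc] CtrTotRel_comp g(1) h(1) \<eta> by blast
    have "g O h\<inverse> \<subseteq> (g O F O g\<inverse>) O ((g O \<eta>) O (h O \<eta>)\<inverse>) O (h O F\<inverse> O h\<inverse>)"
    proof clarify
      fix w w' y assume w: "(w, y) \<in> g" "(w', y) \<in> h"
      then have "y \<in> carrier Y" using CtrTotRelD(1)[OF g(1)] by blast
      then obtain s x where s: "(y, s) \<in> F" "(s, x) \<in> \<eta>" using F(2) unfolding rel_image_def by blast
      then have "s \<in> carrier Y" using CtrTotRelD(1)[OF \<eta>] by blast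
      then obtain w1 w2 where w12: "(w1, s) \<in> g" "(w2, s) \<in> h"
        using CtrTotRelD(3)[OF g(1)] CtrTotRelD(3)[OF h(1)] by blast
      have "(w, w1) \<in> g O F O g\<inverse>" "(w1, w2) \<in> (g O \<eta>) O (h O \<eta>)\<inverse>" "(w2, w') \<in> h O F\<inverse> O h\<inverse>"
        using w s w12 by blast+
      then show "(w, w') \<in> (g O F O g\<inverse>) O ((g O \<eta>) O (h O \<eta>)\<inverse>) O (h O F\<inverse> O h\<inverse>)" by blast
    qed
    then have "g O h\<inverse> \<in> entourages W"
      using entourage_subset[OF Wc entourage_comp[OF Wc CtrTotRelD(2)[OF g(1) F(1)]
          entourage_comp[OF Wc K CtrTotRelD(2)[OF h(1) entourage_converse[OF Yc F(1)]]]]] by blast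
    then show "g' = h'" using mor_eq_iff[OF Yc Wc g(1) h(1)] g h by simp
  qed
qed

section \<open>Coarse subspaces\<close>

lemma set_precI:
  assumes "E \<in> entourages X" "\<And>a. a \<in> A \<Longrightarrow> \<exists>b \<in> B. (a, b) \<in> E"
  shows "set_prec X A B"
  using assms unfolding set_prec_def rel_image_def by blast

lemma set_precE:
  assumes "set_prec X A B"
  obtains E where "E \<in> entourages X" "\<forall>a \<in> A. \<exists>b \<in> B. (a, b) \<in> E"
proof -
  obtain E where E: "E \<in> entourages X" "A \<subseteq> rel_image E B"
    using assms unfolding set_prec_def by blast
  then have "\<forall>a \<in> A. \<exists>b \<in> B. (a, b) \<in> E" unfolding rel_image_def by blast
  then show ?thesis using that E(1) by blast
qed

lemma set_prec_subset:
  assumes "coarse_space X" "A \<subseteq> B" "B \<subseteq> carrier X"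
  shows "set_prec X A B"
  by (rule set_precI[OF entourage_Id[OF assms(1)]]) (use assms(2,3) in blast)

lemma set_prec_trans:
  assumes X: "coarse_space X" and "set_prec X A B" "set_prec X B C"
  shows "set_prec X A C"
proof -
  obtain E where E: "E \<in> entourages X" "\<forall>a \<in> A. \<exists>b \<in> B. (a, b) \<in> E"
    using assms(2) by (rule set_precE)
  obtain F where F: "F \<in> entourages X" "\<forall>a \<in> B. \<exists>b \<in> C. (a, b) \<in> F"
    using assms(3) by (rule set_precE)
  show ?thesis
    by (rule set_precI[OF entourage_comp[OF X E(1) F(1)]]) (use E(2) F(2) in blast)
qed

text \<open>Finiteness matters because the entourages that witness \<open>A \<prec> B\<close> for the different members of
  \<open>T\<close> have to be united to a single one.\<close>

lemma set_prec_Union: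
  assumes X: "coarse_space X" and T: "finite T" and prec: "\<And>A. A \<in> T \<Longrightarrow> set_prec X A B"
  shows "set_prec X (\<Union>T) B"
proof -
  have "\<exists>E \<in> entourages X. \<forall>a \<in> A. \<exists>b \<in> B. (a, b) \<in> E" if "A \<in> T" for A
    using prec[OF that] unfolding set_prec_def rel_image_def by blast
  then obtain E where E: "\<And>A. A \<in> T \<Longrightarrow> E A \<in> entourages X"
    "\<And>A a. A \<in> T \<Longrightarrow> a \<in> A \<Longrightarrow> \<exists>b \<in> B. (a, b) \<in> E A"
    by metis
  have "\<Union>(E ` T) \<in> entourages X" using E(1) T by (intro entourage_Union[OF X]) auto
  then show ?thesis by (rule set_precI) (use E(2) in blast)
qed

lemma rel_image_carrier: "\<eta> \<in> CtrTotRel X Y \<Longrightarrow> rel_image \<eta> S \<subseteq> carrier Y"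
  using CtrTotRelD(1) unfolding rel_image_def by fast

lemma set_prec_rel_image:
  assumes X: "coarse_space X" and \<eta>: "\<eta> \<in> CtrTotRel X Y" and prec: "set_prec X A B"
  shows "set_prec Y (rel_image \<eta> A) (rel_image \<eta> B)"
proof -
  obtain E where E: "E \<in> entourages X" "\<forall>a \<in> A. \<exists>b \<in> B. (a, b) \<in> E"
    using prec by (rule set_precE)
  show ?thesis
  proof (rule set_precI[OF CtrTotRelD(2)[OF \<eta> E(1)]])
    fix y assume "y \<in> rel_image \<eta> A"
    then obtain a b where ab: "(y, a) \<in> \<eta>" "(a, b) \<in> E" "b \<in> B"
      using E(2) unfolding rel_image_def by blast
    then obtain z where "(z, b) \<in> \<eta>" using entourage_carrier[OF X E(1)] CtrTotRelD(3)[OF \<eta>] by blast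
    then show "\<exists>z \<in> rel_image \<eta> B. (y, z) \<in> \<eta> O E O \<eta>\<inverse>" using ab unfolding rel_image_def by blast
  qed
qed

lemma set_prec_rel_image_close:
  assumes \<eta>: "\<eta> O \<xi>\<inverse> \<in> entourages Y" and \<xi>: "\<xi> \<in> CtrTotRel X Y" and S: "S \<subseteq> carrier X"
  shows "set_prec Y (rel_image \<eta> S) (rel_image \<xi> S)"
proof (rule set_precI[OF \<eta>])
  fix y assume "y \<in> rel_image \<eta> S"
  then obtain s where s: "s \<in> S" "(y, s) \<in> \<eta>" unfolding rel_image_def by blast
  then obtain z where "(z, s) \<in> \<xi>" using S CtrTotRelD(3)[OF \<xi>] by blast
  then show "\<exists>z \<in> rel_image \<xi> S. (y, z) \<in> \<eta> O \<xi>\<inverse>" using s unfolding rel_image_def by blast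
qed

lemma equiv_set_sim:
  assumes X: "coarse_space X"
  shows "equiv (Pow (carrier X)) (set_sim X)"
proof (rule equivI)
  show "set_sim X \<subseteq> Pow (carrier X) \<times> Pow (carrier X)" unfolding set_sim_def by blast
  show "refl_on (Pow (carrier X)) (set_sim X)"
    using set_prec_subset[OF X] unfolding refl_on_def set_sim_def by blast
  show "sym (set_sim X)" unfolding sym_def set_sim_def by blast
  show "trans (set_sim X)" using set_prec_trans[OF X] unfolding trans_def set_sim_def by blast
qed

abbreviation coarse_subspace :: "'a coarse \<Rightarrow> 'a set \<Rightarrow> 'a set set" where
  "coarse_subspace X S \<equiv> set_sim X `` {S}"

lemma coarse_subspace_eqI:
  assumes "coarse_space X" "A \<subseteq> carrier X" "B \<subseteq> carrier X" "set_prec X A B" "set_prec X B A"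
  shows "coarse_subspace X A = coarse_subspace X B"
  using equiv_class_eq[OF equiv_set_sim[OF assms(1)]] assms(2-) unfolding set_sim_def by blast

lemma coarse_subspace_self:
  "coarse_space X \<Longrightarrow> S \<subseteq> carrier X \<Longrightarrow> S \<in> coarse_subspace X S"
  using equiv_class_self[OF equiv_set_sim] by blast

lemma Pc_simps:
  "carrier (Pc X) = coarse_subspace X ` Pow (carrier X)" "eq (Pc X) = (=)"
  unfolding Pc_def by (auto simp: quotient_def)

lemma Pc_le_iff:
  assumes X: "coarse_space X" and "A \<subseteq> carrier X" "B \<subseteq> carrier X"
  shows "coarse_subspace X A \<sqsubseteq>\<^bsub>Pc X\<^esub> coarse_subspace X B \<longleftrightarrow> set_prec X A B"
proof
  assume "coarse_subspace X A \<sqsubseteq>\<^bsub>Pc X\<^esub> coarse_subspace X B"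
  then obtain A' B' where "set_prec X A A'" "set_prec X A' B'" "set_prec X B' B"
    unfolding Pc_def set_sim_def by auto
  then show "set_prec X A B" using set_prec_trans[OF X] by blast
next
  assume "set_prec X A B"
  then show "coarse_subspace X A \<sqsubseteq>\<^bsub>Pc X\<^esub> coarse_subspace X B"
    using coarse_subspace_self[OF X assms(2)] coarse_subspace_self[OF X assms(3)]
    unfolding Pc_def gorder.simps by blast
qed

lemma partial_order_Pc:
  assumes X: "coarse_space X"
  shows "partial_order (Pc X)"
proof (rule partial_orderI)
  show "a \<sqsubseteq>\<^bsub>Pc X\<^esub> a" if "a \<in> carrier (Pc X)" for a
    using that Pc_le_iff[OF X] set_prec_subset[OF X] by (auto simp: Pc_simps)
  show "a = b" if ab: "a \<in> carrier (Pc X)" "b \<in> carrier (Pc X)" and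
    le: "a \<sqsubseteq>\<^bsub>Pc X\<^esub> b" "b \<sqsubseteq>\<^bsub>Pc X\<^esub> a" for a b
  proof -
    obtain A B where AB: "A \<subseteq> carrier X" "a = coarse_subspace X A"
      "B \<subseteq> carrier X" "b = coarse_subspace X B"
      using ab unfolding Pc_simps by blast
    then have "set_prec X A B" "set_prec X B A" using le by (simp_all add: Pc_le_iff[OF X])
    then show ?thesis unfolding AB(2,4) by (rule coarse_subspace_eqI[OF X AB(1,3)])
  qed
  show "a \<sqsubseteq>\<^bsub>Pc X\<^esub> c" if "a \<in> carrier (Pc X)" "b \<in> carrier (Pc X)" "c \<in> carrier (Pc X)"
    "a \<sqsubseteq>\<^bsub>Pc X\<^esub> b" "b \<sqsubseteq>\<^bsub>Pc X\<^esub> c" for a b c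
    using that Pc_le_iff[OF X] by (auto simp: Pc_simps intro: set_prec_trans[OF X])
qed (simp add: Pc_simps)

lemma Pc_is_lub_Union:
  assumes X: "coarse_space X" and T: "finite T" "T \<subseteq> Pow (carrier X)"
  shows "is_lub (Pc X) (coarse_subspace X (\<Union>T)) (coarse_subspace X ` T)"
proof -
  have T': "\<Union>T \<subseteq> carrier X" using T(2) by blast
  show ?thesis
    unfolding is_lub_iff
  proof (intro conjI ballI impI)
    show "coarse_subspace X (\<Union>T) \<in> carrier (Pc X)" using T' by (simp add: Pc_simps)
    fix a assume "a \<in> coarse_subspace X ` T \<inter> carrier (Pc X)"
    then obtain A where A: "A \<in> T" "a = coarse_subspace X A" by blast
    then have "set_prec X A (\<Union>T)" using T' by (intro set_prec_subset[OF X]) auto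
    then show "a \<sqsubseteq>\<^bsub>Pc X\<^esub> coarse_subspace X (\<Union>T)" using Pc_le_iff[OF X _ T'] A T(2) by auto
  next
    fix b
    assume "b \<in> carrier (Pc X)"
      and le: "\<forall>a \<in> coarse_subspace X ` T \<inter> carrier (Pc X). a \<sqsubseteq>\<^bsub>Pc X\<^esub> b"
    then obtain B where B: "B \<subseteq> carrier X" "b = coarse_subspace X B" by (auto simp: Pc_simps)
    have "set_prec X A B" if A: "A \<in> T" for A
    proof -
      have A': "A \<subseteq> carrier X" using A T(2) by blast
      then have "coarse_subspace X A \<in> coarse_subspace X ` T \<inter> carrier (Pc X)"
        using A by (simp add: Pc_simps)
      then show ?thesis using le Pc_le_iff[OF X A' B(1)] B(2) by blast
    qed
    then show "coarse_subspace X (\<Union>T) \<sqsubseteq>\<^bsub>Pc X\<^esub> b"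
      using Pc_le_iff[OF X T' B(1)] B(2) set_prec_Union[OF X T(1)] by blast
  qed
qed

lemma finite_join_Pc:
  assumes X: "coarse_space X"
  shows "finite_join (Pc X)"
  unfolding finite_join_def
proof (intro conjI allI impI)
  fix S assume "finite S \<and> S \<subseteq> carrier (Pc X)"
  then obtain T where "finite T" "T \<subseteq> Pow (carrier X)" "S = coarse_subspace X ` T"
    unfolding Pc_simps by (meson finite_subset_image)
  then show "\<exists>x. is_lub (Pc X) x S" using Pc_is_lub_Union[OF X] by blast
qed (rule partial_order_Pc[OF X])

lemma Pc_map_mor:
  assumes X: "coarse_space X" and Y: "coarse_space Y" and \<eta>: "\<eta> \<in> CtrTotRel X Y"
    and S: "S \<subseteq> carrier X"
  shows "Pc_map X Y (mor X Y \<eta>) (coarse_subspace X S) = coarse_subspace Y (rel_image \<eta> S)"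
proof -
  have *: "coarse_subspace Y (rel_image \<xi> A) = coarse_subspace Y (rel_image \<eta> S)"
    if "\<xi> \<in> mor X Y \<eta>" "A \<in> coarse_subspace X S" for \<xi> A
  proof -
    have \<xi>: "\<xi> \<in> CtrTotRel X Y" "\<eta> O \<xi>\<inverse> \<in> entourages Y" "\<xi> O \<eta>\<inverse> \<in> entourages Y"
      using that(1) equiv_close[OF X Y] by (auto simp: close_iff[OF X Y] sym_def equiv_def)
    have A: "A \<subseteq> carrier X" "set_prec X A S" "set_prec X S A"
      using that(2) by (auto simp: set_sim_def)
    show ?thesis
    proof (rule coarse_subspace_eqI[OF Y])
      show "set_prec Y (rel_image \<xi> A) (rel_image \<eta> S)"
        using set_prec_trans[OF Y set_prec_rel_image[OF X \<xi>(1) A(2)]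
            set_prec_rel_image_close[OF \<xi>(3) \<eta> S]] .
      show "set_prec Y (rel_image \<eta> S) (rel_image \<xi> A)"
        using set_prec_trans[OF Y set_prec_rel_image_close[OF \<xi>(2,1) S]
            set_prec_rel_image[OF X \<xi>(1) A(3)]] .
    qed (use rel_image_carrier \<xi>(1) \<eta> in blast)+
  qed
  have "coarse_subspace X S \<in> carrier (Pc X)" using S by (simp add: Pc_simps)
  then have "Pc_map X Y (mor X Y \<eta>) (coarse_subspace X S) =
      (\<Union>\<xi> \<in> mor X Y \<eta>. \<Union>A \<in> coarse_subspace X S. coarse_subspace Y (rel_image \<eta> S))"
    using * by (simp add: Pc_map_def)
  then show ?thesis using mor_self[OF X Y \<eta>] coarse_subspace_self[OF X S] by auto
qed

lemma Pc_map_extensional: "Pc_map X Y f \<in> extensional (carrier (Pc X))"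
  by (simp add: Pc_map_def)

lemma Pc_map_FJ_Hom:
  assumes X: "coarse_space X" and Y: "coarse_space Y" and \<eta>: "\<eta> \<in> CtrTotRel X Y"
  shows "Pc_map X Y (mor X Y \<eta>) \<in> FJ_Hom (Pc X) (Pc Y)"
proof (rule FJ_HomI)
  note map = Pc_map_mor[OF X Y \<eta>]
  note im = rel_image_carrier[OF \<eta>]
  show "Pc_map X Y (mor X Y \<eta>) a \<in> carrier (Pc Y)" if "a \<in> carrier (Pc X)" for a
    using that map im by (auto simp: Pc_simps)
  show "Pc_map X Y (mor X Y \<eta>) a \<sqsubseteq>\<^bsub>Pc Y\<^esub> Pc_map X Y (mor X Y \<eta>) b"
    if "a \<in> carrier (Pc X)" "b \<in> carrier (Pc X)" "a \<sqsubseteq>\<^bsub>Pc X\<^esub> b" for a b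
    using that map im Pc_le_iff[OF X] Pc_le_iff[OF Y] set_prec_rel_image[OF X \<eta>]
    by (auto simp: Pc_simps)
  fix S x assume S: "finite S" "S \<subseteq> carrier (Pc X)" "is_lub (Pc X) x S"
  obtain T where T: "finite T" "T \<subseteq> Pow (carrier X)" "S = coarse_subspace X ` T"
    using S(1,2) unfolding Pc_simps by (meson finite_subset_image)
  have "x = coarse_subspace X (\<Union>T)"
    using is_lub_unique[OF partial_order_Pc[OF X] S(3)] Pc_is_lub_Union[OF X T(1,2)] T(3) by simp
  moreover have "\<Union>T \<subseteq> carrier X" using T(2) by blast
  moreover have "rel_image \<eta> (\<Union>T) = \<Union>(rel_image \<eta> ` T)" unfolding rel_image_def by blast
  ultimately have x: "Pc_map X Y (mor X Y \<eta>) x = coarse_subspace Y (\<Union>(rel_image \<eta> ` T))"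
    using map by simp
  have "Pc_map X Y (mor X Y \<eta>) ` S = coarse_subspace Y ` (rel_image \<eta> ` T)"
    unfolding T(3) image_image using map T(2) by (intro image_cong) auto
  moreover have "rel_image \<eta> ` T \<subseteq> Pow (carrier Y)" by (simp add: im image_subset_iff)
  ultimately show "is_lub (Pc Y) (Pc_map X Y (mor X Y \<eta>) x) (Pc_map X Y (mor X Y \<eta>) ` S)"
    unfolding x using Pc_is_lub_Union[OF Y finite_imageI[OF T(1)]] by simp
qed (use finite_join_Pc X Y Pc_map_extensional in auto)

lemma cat_functor_Pc: "cat_functor (Coarse U) FJ_Par \<lparr>FOb = Pc, FMor = Pc_map\<rparr>"
  unfolding cat_functor_def cfunctor.simps FJ_Par_simps
proof (intro conjI ballI)
  show "category (Coarse U)" "category FJ_Par" by (rule category_Coarse category_FJ_Par)+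
next
  fix X assume "X \<in> Ob (Coarse U)"
  then have X: "coarse_space X" by (simp add: Coarse_simps)
  then show "Pc X \<in> {P. finite_join P}" using finite_join_Pc by simp
  have "Pc_map X X (Ident (Coarse U) X) a = a" if a: "a \<in> carrier (Pc X)" for a
  proof -
    obtain S where S: "S \<subseteq> carrier X" "a = coarse_subspace X S" using a by (auto simp: Pc_simps)
    have "rel_image (Id_on (carrier X)) S = S" using S(1) unfolding rel_image_def by blast
    then show ?thesis using Pc_map_mor[OF X X CtrTotRel_Id[OF X] S(1)] S(2)
      by (simp add: Coarse_simps(3))
  qed
  then show "Pc_map X X (Ident (Coarse U) X) = (\<lambda>a \<in> carrier (Pc X). a)"
    by (intro extensionalityI[OF Pc_map_extensional]) auto
next
  fix X Y f assume ob: "X \<in> Ob (Coarse U)" "Y \<in> Ob (Coarse U)" and "f \<in> Hom (Coarse U) X Y"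
  then obtain \<eta> where "\<eta> \<in> CtrTotRel X Y" "f = mor X Y \<eta>" by (elim Coarse_HomE)
  then show "Pc_map X Y f \<in> FJ_Hom (Pc X) (Pc Y)"
    using ob by (simp add: Pc_map_FJ_Hom Coarse_simps(1))
next
  fix X Y Z f g
  assume ob: "X \<in> Ob (Coarse U)" "Y \<in> Ob (Coarse U)" "Z \<in> Ob (Coarse U)"
    and f: "f \<in> Hom (Coarse U) X Y" and g: "g \<in> Hom (Coarse U) Y Z"
  have X: "coarse_space X" and Y: "coarse_space Y" and Z: "coarse_space Z"
    using ob by (simp_all add: Coarse_simps)
  obtain \<eta> where \<eta>: "\<eta> \<in> CtrTotRel X Y" "f = mor X Y \<eta>" using f by (rule Coarse_HomE)
  obtain \<xi> where \<xi>: "\<xi> \<in> CtrTotRel Y Z" "g = mor Y Z \<xi>" using g by (rule Coarse_HomE)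
  have "Pc_map X Z (Comp (Coarse U) X Y Z g f) a = Pc_map Y Z g (Pc_map X Y f a)"
    if a: "a \<in> carrier (Pc X)" for a
  proof -
    obtain S where S: "S \<subseteq> carrier X" "a = coarse_subspace X S" using a by (auto simp: Pc_simps)
    show ?thesis
      using S rel_image_carrier[OF \<eta>(1), of S]
      by (simp add: \<eta>(2) \<xi>(2) Comp_mor[OF X Y Z \<eta>(1) \<xi>(1)] Pc_map_mor[OF X Y \<eta>(1)]
          Pc_map_mor[OF Y Z \<xi>(1)] Pc_map_mor[OF X Z CtrTotRel_comp[OF \<eta>(1) \<xi>(1)]] rel_image_comp)
  qed
  then show "Pc_map X Z (Comp (Coarse U) X Y Z g f) =
      compose (carrier (Pc X)) (Pc_map Y Z g) (Pc_map X Y f)"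
    by (intro extensionalityI[OF Pc_map_extensional]) (auto simp: compose_def)
qed

section \<open>Subobjects of coarse spaces\<close>

lemma monos_into_CoarseE:
  assumes "set_universe U" "X \<in> Ob (Coarse U)" "(Z, h) \<in> monos_into (Coarse U) X"
  obtains \<eta> where "Z \<in> Ob (Coarse U)" "\<eta> \<in> CtrTotRel Z X" "h = mor Z X \<eta>" "coarse_embedding Z X \<eta>"
proof -
  have Z: "Z \<in> Ob (Coarse U)" and m: "monic (Coarse U) Z X h"
    using assms(3) by (auto simp: monos_into_def)
  then have "h \<in> Hom (Coarse U) Z X" by (simp add: monic_def)
  then obtain \<eta> where \<eta>: "\<eta> \<in> CtrTotRel Z X" "h = mor Z X \<eta>" by (rule Coarse_HomE)
  show ?thesis using that Z \<eta> m monic_mor_iff[OF assms(1) Z assms(2) \<eta>(1)] by blast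
qed

lemma monos_into_CoarseI:
  assumes "set_universe U" "X \<in> Ob (Coarse U)" "Z \<in> Ob (Coarse U)" "\<eta> \<in> CtrTotRel Z X"
    "coarse_embedding Z X \<eta>"
  shows "(Z, mor Z X \<eta>) \<in> monos_into (Coarse U) X"
  using monic_mor_iff[OF assms(1,3,2,4)] assms(3,5) by (simp add: monos_into_def)

lemma Domain_carrier: "\<eta> \<in> CtrTotRel X Y \<Longrightarrow> Domain \<eta> \<subseteq> carrier Y"
  using CtrTotRelD(1) by blast

lemma Domain_eq_rel_image: "\<eta> \<in> CtrTotRel X Y \<Longrightarrow> Domain \<eta> = rel_image \<eta> (carrier X)"
  using CtrTotRelD(1) unfolding rel_image_def by fast

lemma mor_Domain_sim:
  assumes X: "coarse_space X" and Y: "coarse_space Y" and \<eta>: "\<eta> \<in> CtrTotRel X Y"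
    and "\<xi> \<in> mor X Y \<eta>"
  shows "(Domain \<eta>, Domain \<xi>) \<in> set_sim Y"
proof -
  have \<xi>: "\<xi> \<in> CtrTotRel X Y" "\<eta> O \<xi>\<inverse> \<in> entourages Y" "\<xi> O \<eta>\<inverse> \<in> entourages Y"
    using assms(4) equiv_close[OF X Y] by (auto simp: close_iff[OF X Y] sym_def equiv_def)
  have "set_prec Y (Domain \<eta>) (Domain \<xi>)" "set_prec Y (Domain \<xi>) (Domain \<eta>)"
    unfolding Domain_eq_rel_image[OF \<eta>] Domain_eq_rel_image[OF \<xi>(1)]
    using set_prec_rel_image_close[OF \<xi>(2,1)] set_prec_rel_image_close[OF \<xi>(3) \<eta>] by auto
  then show ?thesis using Domain_carrier \<eta> \<xi>(1) unfolding set_sim_def by blast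
qed

text \<open>In the converse direction, an entourage \<open>F\<close> that relates every point in the range of \<open>\<eta>1\<close> to
  one in the range of \<open>\<eta>2\<close> yields the candidate \<open>\<phi> = \<eta>2\<dagger> \<circ> F\<dagger> \<circ> \<eta>1\<close>. It is total by the choice
  of \<open>F\<close>, controlled because \<open>\<eta>2\<close> is an embedding, and \<open>\<eta>2 \<circ> \<phi>\<close> differs from \<open>\<eta>1\<close> by the entourage
  \<open>\<eta>2 \<circ> \<eta>2\<dagger> \<circ> F\<dagger>\<close>.\<close>

lemma factors_through_embedding_iff:
  assumes Z1: "coarse_space Z1" and Z2: "coarse_space Z2" and X: "coarse_space X"
    and \<eta>1: "\<eta>1 \<in> CtrTotRel Z1 X" and \<eta>2: "\<eta>2 \<in> CtrTotRel Z2 X"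
    and emb: "coarse_embedding Z2 X \<eta>2"
  shows "(\<exists>\<phi> \<in> Hom (Coarse U) Z1 Z2. Comp (Coarse U) Z1 Z2 X (mor Z2 X \<eta>2) \<phi> = mor Z1 X \<eta>1) \<longleftrightarrow>
    set_prec X (Domain \<eta>1) (Domain \<eta>2)"
proof
  assume "\<exists>\<phi> \<in> Hom (Coarse U) Z1 Z2. Comp (Coarse U) Z1 Z2 X (mor Z2 X \<eta>2) \<phi> = mor Z1 X \<eta>1"
  then obtain \<phi> where \<phi>: "\<phi> \<in> CtrTotRel Z1 Z2"
    "Comp (Coarse U) Z1 Z2 X (mor Z2 X \<eta>2) (mor Z1 Z2 \<phi>) = mor Z1 X \<eta>1"
    by (auto elim: Coarse_HomE)
  then have "mor Z1 X (\<eta>2 O \<phi>) = mor Z1 X \<eta>1" by (simp add: Comp_mor[OF Z1 Z2 X] \<eta>2)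
  then have "\<eta>1 \<in> mor Z1 X (\<eta>2 O \<phi>)" using mor_self[OF Z1 X \<eta>1] by simp
  then have "set_prec X (Domain \<eta>1) (Domain (\<eta>2 O \<phi>))"
    using mor_Domain_sim[OF Z1 X CtrTotRel_comp[OF \<phi>(1) \<eta>2]] by (auto simp: set_sim_def)
  moreover have "set_prec X (Domain (\<eta>2 O \<phi>)) (Domain \<eta>2)"
    using Domain_carrier[OF \<eta>2] by (intro set_prec_subset[OF X]) auto
  ultimately show "set_prec X (Domain \<eta>1) (Domain \<eta>2)" by (rule set_prec_trans[OF X])
next
  assume "set_prec X (Domain \<eta>1) (Domain \<eta>2)"
  then obtain F where F: "F \<in> entourages X" "\<forall>a \<in> Domain \<eta>1. \<exists>b \<in> Domain \<eta>2. (a, b) \<in> F"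
    by (rule set_precE)
  define \<phi> where "\<phi> = \<eta>2\<inverse> O F\<inverse> O \<eta>1"
  have \<phi>: "\<phi> \<in> CtrTotRel Z1 Z2"
  proof (rule CtrTotRelI)
    show "\<phi> \<subseteq> carrier Z2 \<times> carrier Z1"
      using CtrTotRelD(1)[OF \<eta>1] CtrTotRelD(1)[OF \<eta>2] unfolding \<phi>_def by blast
    fix E assume "E \<in> entourages Z1"
    then have "F\<inverse> O (\<eta>1 O E O \<eta>1\<inverse>) O F \<in> entourages X"
      using CtrTotRelD(2)[OF \<eta>1] F(1) entourage_comp[OF X] entourage_converse[OF X] by blast
    then have "\<eta>2\<inverse> O (F\<inverse> O (\<eta>1 O E O \<eta>1\<inverse>) O F) O \<eta>2 \<in> entourages Z2"
      using emb by (simp add: coarse_embedding_def)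
    then show "\<phi> O E O \<phi>\<inverse> \<in> entourages Z2" by (simp add: \<phi>_def converse_relcomp O_assoc)
  next
    fix z assume "z \<in> carrier Z1"
    then obtain x where x: "(x, z) \<in> \<eta>1" using CtrTotRelD(3)[OF \<eta>1] by blast
    then obtain y w where "(x, y) \<in> F" "(y, w) \<in> \<eta>2" using F(2) by blast
    then show "\<exists>w. (w, z) \<in> \<phi>" unfolding \<phi>_def using x by blast
  qed
  have "(\<eta>2 O \<phi>) O \<eta>1\<inverse> = (\<eta>2 O \<eta>2\<inverse>) O F\<inverse> O (\<eta>1 O \<eta>1\<inverse>)" by (simp add: \<phi>_def O_assoc)
  also have "\<dots> \<in> entourages X"
    using CtrTotRel_diag[OF Z2 \<eta>2] CtrTotRel_diag[OF Z1 \<eta>1] entourage_comp[OF X] entourage_converse[OF X F(1)] by blast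
  finally have "mor Z1 X (\<eta>2 O \<phi>) = mor Z1 X \<eta>1"
    using mor_eq_iff[OF Z1 X CtrTotRel_comp[OF \<phi> \<eta>2] \<eta>1] by simp
  then show "\<exists>\<phi> \<in> Hom (Coarse U) Z1 Z2. Comp (Coarse U) Z1 Z2 X (mor Z2 X \<eta>2) \<phi> = mor Z1 X \<eta>1"
    using mor_in_Hom[OF \<phi>] Comp_mor[OF Z1 Z2 X \<phi> \<eta>2] by metis
qed

text \<open>Two monomorphisms that factor through each other do so by mutually inverse morphisms: both
  composites become identities after the monomorphism is cancelled.\<close>

lemma (in category) iso_over_iff:
  assumes "X \<in> Ob C" and h1: "(Z1, h1) \<in> monos_into C X" and h2: "(Z2, h2) \<in> monos_into C X"
  shows "((Z1, h1), (Z2, h2)) \<in> iso_over C X \<longleftrightarrow>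
    (\<exists>\<phi> \<in> Hom C Z1 Z2. Comp C Z1 Z2 X h2 \<phi> = h1) \<and> (\<exists>\<psi> \<in> Hom C Z2 Z1. Comp C Z2 Z1 X h1 \<psi> = h2)"
proof
  have Z: "Z1 \<in> Ob C" "Z2 \<in> Ob C" and m: "h1 \<in> Hom C Z1 X" "h2 \<in> Hom C Z2 X"
    using h1 h2 by (auto simp: monos_into_def monic_def)
  assume "((Z1, h1), (Z2, h2)) \<in> iso_over C X"
  then obtain \<phi> \<psi> where \<phi>: "\<phi> \<in> Hom C Z1 Z2" "Comp C Z1 Z2 X h2 \<phi> = h1"
    and \<psi>: "\<psi> \<in> Hom C Z2 Z1" "Comp C Z2 Z1 Z2 \<phi> \<psi> = Ident C Z2"
    unfolding iso_over_def is_iso_def by auto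
  have "Comp C Z2 Z1 X h1 \<psi> = h2"
    using comp_assoc[OF Z(2,1,2) assms(1) \<psi>(1) \<phi>(1) m(2)] \<phi>(2) \<psi>(2)
      comp_ident_right[OF Z(2) assms(1) m(2)] by simp
  then show "(\<exists>\<phi> \<in> Hom C Z1 Z2. Comp C Z1 Z2 X h2 \<phi> = h1) \<and> (\<exists>\<psi> \<in> Hom C Z2 Z1. Comp C Z2 Z1 X h1 \<psi> = h2)"
    using \<phi> \<psi>(1) by blast
next
  have Z: "Z1 \<in> Ob C" "Z2 \<in> Ob C" and m: "h1 \<in> Hom C Z1 X" "h2 \<in> Hom C Z2 X"
    using h1 h2 by (auto simp: monos_into_def monic_def)
  have cancel: "Comp C A B A \<beta> \<alpha> = Ident C A"
    if "A \<in> Ob C" "B \<in> Ob C" "monic C A X h" "\<alpha> \<in> Hom C A B" "\<beta> \<in> Hom C B A" "k \<in> Hom C B X"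
      "Comp C A B X k \<alpha> = h" "Comp C B A X h \<beta> = k" for A B h k \<alpha> \<beta>
  proof -
    have h: "h \<in> Hom C A X" using that(3) by (simp add: monic_def)
    have "Comp C A A X h (Comp C A B A \<beta> \<alpha>) = h"
      using comp_assoc[OF that(1,2,1) assms(1) that(4,5) h] that(7,8) by simp
    moreover have "Comp C A A X h (Ident C A) = h" using comp_ident_right[OF that(1) assms(1) h] .
    ultimately show ?thesis
      using that(3) comp_in_hom[OF that(1,2,1,4,5)] ident_in_hom[OF that(1)] that(1)
      unfolding monic_def by auto
  qed
  assume "(\<exists>\<phi> \<in> Hom C Z1 Z2. Comp C Z1 Z2 X h2 \<phi> = h1) \<and> (\<exists>\<psi> \<in> Hom C Z2 Z1. Comp C Z2 Z1 X h1 \<psi> = h2)"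
  then obtain \<phi> \<psi> where \<phi>: "\<phi> \<in> Hom C Z1 Z2" "Comp C Z1 Z2 X h2 \<phi> = h1"
    and \<psi>: "\<psi> \<in> Hom C Z2 Z1" "Comp C Z2 Z1 X h1 \<psi> = h2" by blast
  have "monic C Z1 X h1" "monic C Z2 X h2" using h1 h2 by (auto simp: monos_into_def)
  then have "is_iso C Z1 Z2 \<phi>"
    unfolding is_iso_def using cancel Z m \<phi> \<psi> by blast
  then show "((Z1, h1), (Z2, h2)) \<in> iso_over C X" unfolding iso_over_def using h1 h2 \<phi>(2) by blast
qed

text \<open>The isomorphism from \<open>\<P>\<^sub>c X\<close> to the subobjects of \<open>X\<close>, written without choosing
  representatives: the range of \<open>\<eta>\<close> is \<open>Domain \<eta>\<close>, as pairs are \<open>(target, source)\<close>.\<close>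

definition subobjects_onto :: "'a set set \<Rightarrow> 'a coarse \<Rightarrow> 'a set set \<Rightarrow> 'a subobject" where
  "subobjects_onto U X a = {(Z, h). (Z, h) \<in> monos_into (Coarse U) X \<and> (\<exists>\<eta> \<in> h. Domain \<eta> \<in> a)}"

lemma mem_subobjects_onto_iff:
  assumes Z: "coarse_space Z" and X: "coarse_space X" and \<eta>: "\<eta> \<in> CtrTotRel Z X"
    and S: "S \<subseteq> carrier X"
  shows "(Z, mor Z X \<eta>) \<in> subobjects_onto U X (coarse_subspace X S) \<longleftrightarrow>
    (Z, mor Z X \<eta>) \<in> monos_into (Coarse U) X \<and> set_prec X S (Domain \<eta>) \<and> set_prec X (Domain \<eta>) S"
proof -
  have "(\<exists>\<xi> \<in> mor Z X \<eta>. Domain \<xi> \<in> coarse_subspace X S) \<longleftrightarrow> (S, Domain \<eta>) \<in> set_sim X"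
  proof
    assume "(S, Domain \<eta>) \<in> set_sim X"
    then show "\<exists>\<xi> \<in> mor Z X \<eta>. Domain \<xi> \<in> coarse_subspace X S"
      by (intro bexI[OF _ mor_self[OF Z X \<eta>]]) simp
  next
    assume "\<exists>\<xi> \<in> mor Z X \<eta>. Domain \<xi> \<in> coarse_subspace X S"
    then obtain \<xi> where \<xi>: "\<xi> \<in> mor Z X \<eta>" "(S, Domain \<xi>) \<in> set_sim X" by auto
    have "sym (set_sim X)" "trans (set_sim X)"
      using equiv_set_sim[OF X] by (simp_all add: equiv_def)
    then show "(S, Domain \<eta>) \<in> set_sim X"
      using \<xi>(2) mor_Domain_sim[OF Z X \<eta> \<xi>(1)] by (meson symD transD)
  qed
  then show ?thesis
    using S Domain_carrier[OF \<eta>] unfolding subobjects_onto_def set_sim_def by auto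
qed

text \<open>Isomorphism over \<open>X\<close> is mutual factorization, hence mutual \<open>\<prec>\<close> of the ranges.\<close>

lemma iso_over_class_eq:
  assumes U: "set_universe U"
    and X: "X \<in> Ob (Coarse U)" and h: "(Z, mor Z X \<eta>) \<in> monos_into (Coarse U) X"
    and \<eta>: "\<eta> \<in> CtrTotRel Z X"
  shows "iso_over (Coarse U) X `` {(Z, mor Z X \<eta>)} = subobjects_onto U X (coarse_subspace X (Domain \<eta>))"
proof -
  have Xc: "coarse_space X" using X by (simp add: Coarse_simps)
  have ZO: "Z \<in> Ob (Coarse U)" and m: "monic (Coarse U) Z X (mor Z X \<eta>)"
    using h by (auto simp: monos_into_def)
  have Z: "coarse_space Z" using ZO by (simp add: Coarse_simps)
  have emb: "coarse_embedding Z X \<eta>" using monic_mor_iff[OF U ZO X \<eta>] m by blast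
  have "((Z, mor Z X \<eta>), (W, k)) \<in> iso_over (Coarse U) X \<longleftrightarrow>
      (W, k) \<in> subobjects_onto U X (coarse_subspace X (Domain \<eta>))"
    if k: "(W, k) \<in> monos_into (Coarse U) X" for W k
  proof -
    obtain \<xi> where \<xi>: "W \<in> Ob (Coarse U)"
      "\<xi> \<in> CtrTotRel W X" "k = mor W X \<xi>" "coarse_embedding W X \<xi>"
      using U X k by (rule monos_into_CoarseE)
    have W: "coarse_space W" using \<xi>(1) by (simp add: Coarse_simps)
    show ?thesis
      using category.iso_over_iff[OF category_Coarse X h k] k
        mem_subobjects_onto_iff[OF W Xc \<xi>(2) Domain_carrier[OF \<eta>]]
        factors_through_embedding_iff[OF Z W Xc \<eta> \<xi>(2,4)]
          factors_through_embedding_iff[OF W Z Xc \<xi>(2) \<eta> emb]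
      unfolding \<xi>(3) by blast
  qed
  moreover have "iso_over (Coarse U) X `` {(Z, mor Z X \<eta>)} \<subseteq> monos_into (Coarse U) X"
    "subobjects_onto U X (coarse_subspace X (Domain \<eta>)) \<subseteq> monos_into (Coarse U) X"
    unfolding iso_over_def subobjects_onto_def by auto
  ultimately show ?thesis by auto
qed

definition restriction :: "'a coarse \<Rightarrow> 'a set \<Rightarrow> 'a coarse" where
  "restriction X S = \<lparr>carrier = S, entourages = {E \<in> entourages X. E \<subseteq> S \<times> S}\<rparr>"

lemma restriction_Ob:
  assumes U: "set_universe U" and X: "X \<in> Ob (Coarse U)" and S: "S \<subseteq> carrier X"
  shows "restriction X S \<in> Ob (Coarse U)"
proof -
  have Xc: "coarse_space X" and XU: "carrier X \<in> U" using X by (simp_all add: Coarse_simps)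
  have "coarse_structure S {E \<in> entourages X. E \<subseteq> S \<times> S}"
  proof (rule coarse_structureI)
    have "Id_on S \<subseteq> Id_on (carrier X)" using S by blast
    then show "Id_on S \<in> {E \<in> entourages X. E \<subseteq> S \<times> S}"
      using entourage_subset[OF Xc entourage_Id[OF Xc]] by auto
  qed (use entourage_comp[OF Xc] entourage_converse[OF Xc] entourage_Un[OF Xc] entourage_subset[OF Xc] in blast)+
  then show ?thesis using set_universeD(2)[OF U XU S] by (simp add: Coarse_simps restriction_def)
qed

lemma restriction_inclusion:
  assumes X: "coarse_space X" and S: "S \<subseteq> carrier X"
  shows "Id_on S \<in> CtrTotRel (restriction X S) X" "coarse_embedding (restriction X S) X (Id_on S)"
proof -
  have sub: "Id_on S O E O (Id_on S)\<inverse> \<subseteq> E" "(Id_on S)\<inverse> O E O Id_on S \<subseteq> E \<inter> S \<times> S" for E by auto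
  show "Id_on S \<in> CtrTotRel (restriction X S) X"
  proof (rule CtrTotRelI)
    fix E assume "E \<in> entourages (restriction X S)"
    then have "E \<in> entourages X" by (simp add: restriction_def)
    then show "Id_on S O E O (Id_on S)\<inverse> \<in> entourages X"
      using entourage_subset[OF X _ sub(1)] by blast
  qed (use S in \<open>auto simp: restriction_def\<close>)
  show "coarse_embedding (restriction X S) X (Id_on S)"
    unfolding coarse_embedding_def
  proof
    fix F assume "F \<in> entourages X"
    then have "(Id_on S)\<inverse> O F O Id_on S \<in> entourages X" using entourage_subset[OF X] sub(2) by blast
    then show "(Id_on S)\<inverse> O F O Id_on S \<in> entourages (restriction X S)"
      using sub(2) by (simp add: restriction_def)
  qed
qed

lemma Sub_simps:
  "carrier (Sub C X) = monos_into C X // iso_over C X" "eq (Sub C X) = (=)"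
  by (simp_all add: Sub_def)

lemma Sub_le_iff_ex:
  "a \<sqsubseteq>\<^bsub>Sub C X\<^esub> b \<longleftrightarrow> (\<exists>Z1 h1 Z2 h2. (Z1, h1) \<in> a \<and> (Z2, h2) \<in> b \<and>
    (\<exists>\<phi> \<in> Hom C Z1 Z2. Comp C Z1 Z2 X h2 \<phi> = h1))"
  unfolding Sub_def by fastforce

lemma restriction_mem_subobjects_onto:
  assumes U: "set_universe U" and X: "X \<in> Ob (Coarse U)" and S: "S \<subseteq> carrier X"
  shows "(restriction X S, mor (restriction X S) X (Id_on S)) \<in> subobjects_onto U X (coarse_subspace X S)"
proof -
  have Xc: "coarse_space X" using X by (simp add: Coarse_simps)
  note r = restriction_Ob[OF U X S] and i = restriction_inclusion[OF Xc S]
  have rc: "coarse_space (restriction X S)" using r by (simp add: Coarse_simps)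
  show ?thesis
    unfolding mem_subobjects_onto_iff[OF rc Xc i(1) S]
    using monos_into_CoarseI[OF U X r i] set_prec_subset[OF Xc _ S] by simp
qed

lemma carrier_Sub_Coarse:
  assumes U: "set_universe U" and X: "X \<in> Ob (Coarse U)"
  shows "carrier (Sub (Coarse U) X) = subobjects_onto U X ` carrier (Pc X)"
proof
  have Xc: "coarse_space X" using X by (simp add: Coarse_simps)
  show "carrier (Sub (Coarse U) X) \<subseteq> subobjects_onto U X ` carrier (Pc X)"
  proof
    fix b assume "b \<in> carrier (Sub (Coarse U) X)"
    then obtain Z h where h: "(Z, h) \<in> monos_into (Coarse U) X"
      "b = iso_over (Coarse U) X `` {(Z, h)}"
      unfolding Sub_simps by (auto elim: quotientE)
    obtain \<eta> where \<eta>: "\<eta> \<in> CtrTotRel Z X" "h = mor Z X \<eta>"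
      using U X h(1) by (rule monos_into_CoarseE)
    show "b \<in> subobjects_onto U X ` carrier (Pc X)"
      using iso_over_class_eq[OF U X _ \<eta>(1)] h \<eta> Domain_carrier[OF \<eta>(1)] by (auto simp: Pc_simps)
  qed
  show "subobjects_onto U X ` carrier (Pc X) \<subseteq> carrier (Sub (Coarse U) X)"
  proof clarify
    fix a assume "a \<in> carrier (Pc X)"
    then obtain S where S: "S \<subseteq> carrier X" "a = coarse_subspace X S" by (auto simp: Pc_simps)
    have m: "(restriction X S, mor (restriction X S) X (Id_on S)) \<in> monos_into (Coarse U) X"
      using restriction_mem_subobjects_onto[OF U X S(1)] by (simp add: subobjects_onto_def)
    have "subobjects_onto U X a = iso_over (Coarse U) X `` {(restriction X S, mor (restriction X S) X (Id_on S))}"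
      using iso_over_class_eq[OF U X m restriction_inclusion(1)[OF Xc S(1)]] S(2) by simp
    then show "subobjects_onto U X a \<in> carrier (Sub (Coarse U) X)"
      unfolding Sub_simps using m by (simp add: quotientI)
  qed
qed

lemma subobjects_ontoE:
  assumes U: "set_universe U" and X: "X \<in> Ob (Coarse U)" and S: "S \<subseteq> carrier X"
    and h: "(Z, h) \<in> subobjects_onto U X (coarse_subspace X S)"
  obtains \<eta> where "Z \<in> Ob (Coarse U)" "\<eta> \<in> CtrTotRel Z X" "h = mor Z X \<eta>" "coarse_embedding Z X \<eta>"
    "set_prec X S (Domain \<eta>)" "set_prec X (Domain \<eta>) S"
proof -
  have "(Z, h) \<in> monos_into (Coarse U) X" using h by (simp add: subobjects_onto_def)
  then obtain \<eta> where \<eta>: "Z \<in> Ob (Coarse U)"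
    "\<eta> \<in> CtrTotRel Z X" "h = mor Z X \<eta>" "coarse_embedding Z X \<eta>"
    using U X by (elim monos_into_CoarseE)
  have "coarse_space Z" "coarse_space X" using X \<eta>(1) by (simp_all add: Coarse_simps)
  then show ?thesis using that[OF \<eta>] mem_subobjects_onto_iff[OF _ _ \<eta>(2) S] h \<eta>(3) by blast
qed

lemma Sub_le_iff:
  assumes U: "set_universe U" and X: "X \<in> Ob (Coarse U)"
    and A: "A \<subseteq> carrier X" and B: "B \<subseteq> carrier X"
  shows "subobjects_onto U X (coarse_subspace X A) \<sqsubseteq>\<^bsub>Sub (Coarse U) X\<^esub>
      subobjects_onto U X (coarse_subspace X B) \<longleftrightarrow> set_prec X A B"
proof -
  have Xc: "coarse_space X" using X by (simp add: Coarse_simps)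
  let ?F = "\<lambda>Z1 h1 Z2 h2. \<exists>\<phi> \<in> Hom (Coarse U) Z1 Z2. Comp (Coarse U) Z1 Z2 X h2 \<phi> = h1"
  have *: "?F Z1 h1 Z2 h2 \<longleftrightarrow> set_prec X A B"
    if h1: "(Z1, h1) \<in> subobjects_onto U X (coarse_subspace X A)"
      and h2: "(Z2, h2) \<in> subobjects_onto U X (coarse_subspace X B)" for Z1 h1 Z2 h2
  proof -
    obtain \<eta>1 where \<eta>1: "Z1 \<in> Ob (Coarse U)" "\<eta>1 \<in> CtrTotRel Z1 X" "h1 = mor Z1 X \<eta>1"
      "set_prec X A (Domain \<eta>1)" "set_prec X (Domain \<eta>1) A"
      using U X A h1 by (rule subobjects_ontoE)
    obtain \<eta>2 where \<eta>2: "Z2 \<in> Ob (Coarse U)" "\<eta>2 \<in> CtrTotRel Z2 X" "h2 = mor Z2 X \<eta>2"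
      "coarse_embedding Z2 X \<eta>2" "set_prec X B (Domain \<eta>2)" "set_prec X (Domain \<eta>2) B"
      using U X B h2 by (rule subobjects_ontoE)
    have "?F Z1 h1 Z2 h2 \<longleftrightarrow> set_prec X (Domain \<eta>1) (Domain \<eta>2)"
      unfolding \<eta>1(3) \<eta>2(3)
      by (rule factors_through_embedding_iff) (use \<eta>1 \<eta>2 Xc in \<open>auto simp: Coarse_simps\<close>)
    also have "\<dots> \<longleftrightarrow> set_prec X A B"
      using \<eta>1(4,5) \<eta>2(5,6) set_prec_trans[OF Xc] by meson
    finally show ?thesis .
  qed
  show ?thesis
    unfolding Sub_le_iff_ex
    using * restriction_mem_subobjects_onto[OF U X A] restriction_mem_subobjects_onto[OF U X B]
    by metis
qed

lemma order_iso_Pc_Sub: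
  assumes U: "set_universe U" and X: "X \<in> Ob (Coarse U)"
  shows "order_iso (Pc X) (Sub (Coarse U) X) (subobjects_onto U X)"
proof -
  have Xc: "coarse_space X" using X by (simp add: Coarse_simps)
  have le: "subobjects_onto U X a \<sqsubseteq>\<^bsub>Sub (Coarse U) X\<^esub> subobjects_onto U X b \<longleftrightarrow> a \<sqsubseteq>\<^bsub>Pc X\<^esub> b"
    if "a \<in> carrier (Pc X)" "b \<in> carrier (Pc X)" for a b
    using that Sub_le_iff[OF U X] Pc_le_iff[OF Xc] by (auto simp: Pc_simps)
  have "inj_on (subobjects_onto U X) (carrier (Pc X))"
  proof (rule inj_onI)
    interpret partial_order "Pc X" using partial_order_Pc[OF Xc] .
    fix a b assume ab: "a \<in> carrier (Pc X)"
      "b \<in> carrier (Pc X)" "subobjects_onto U X a = subobjects_onto U X b"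
    then have "a \<sqsubseteq>\<^bsub>Pc X\<^esub> b" "b \<sqsubseteq>\<^bsub>Pc X\<^esub> a"
      using le[OF ab(1,2)] le[OF ab(2,1)] le[OF ab(1,1)] by simp_all
    then show "a = b" using ab(1,2) by (rule le_antisym)
  qed
  then show ?thesis
    unfolding order_iso_def bij_betw_def
    using le carrier_Sub_Coarse[OF U X] by (simp add: Sub_simps)
qed

text \<open>Every morphism factors through its range with the restricted structure. The same relation
  \<open>\<eta>\<close> serves as the epimorphism.\<close>

lemma image_factorization:
  assumes U: "set_universe U" and X: "X \<in> Ob (Coarse U)" and Y: "Y \<in> Ob (Coarse U)"
    and \<eta>: "\<eta> \<in> CtrTotRel X Y"
  defines "I \<equiv> restriction Y (Domain \<eta>)"
  shows "I \<in> Ob (Coarse U)" "\<eta> \<in> CtrTotRel X I" "epic (Coarse U) X I (mor X I \<eta>)"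
    "monic (Coarse U) I Y (mor I Y (Id_on (Domain \<eta>)))"
    "Comp (Coarse U) X I Y (mor I Y (Id_on (Domain \<eta>))) (mor X I \<eta>) = mor X Y \<eta>"
proof -
  have Xc: "coarse_space X" and Yc: "coarse_space Y" using X Y by (simp_all add: Coarse_simps)
  show I: "I \<in> Ob (Coarse U)" unfolding I_def by (rule restriction_Ob[OF U Y Domain_carrier[OF \<eta>]])
  then have Ic: "coarse_space I" by (simp add: Coarse_simps)
  show \<eta>I: "\<eta> \<in> CtrTotRel X I"
  proof (rule CtrTotRelI)
    show "\<eta> O E O \<eta>\<inverse> \<in> entourages I" if "E \<in> entourages X" for E
      using CtrTotRelD(2)[OF \<eta> that] unfolding I_def restriction_def by auto
  qed (use CtrTotRelD(1,3)[OF \<eta>] in \<open>auto simp: I_def restriction_def\<close>)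
  have "carrier I = Domain \<eta>" by (simp add: I_def restriction_def)
  then show "epic (Coarse U) X I (mor X I \<eta>)"
    using epic_mor_iff[OF U X I \<eta>I] set_prec_subset[OF Ic] by simp
  have i: "Id_on (Domain \<eta>) \<in> CtrTotRel I Y" "coarse_embedding I Y (Id_on (Domain \<eta>))"
    unfolding I_def using restriction_inclusion[OF Yc Domain_carrier[OF \<eta>]] by blast+
  show "monic (Coarse U) I Y (mor I Y (Id_on (Domain \<eta>)))"
    using monic_mor_iff[OF U I Y i(1)] i(2) by blast
  have "Id_on (Domain \<eta>) O \<eta> = \<eta>" by auto
  then show "Comp (Coarse U) X I Y (mor I Y (Id_on (Domain \<eta>))) (mor X I \<eta>) = mor X Y \<eta>"
    using Comp_mor[OF Xc Ic Yc \<eta>I i(1)] by simp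
qed

text \<open>Whatever representative \<open>(Z, h)\<close> and factorization \<open>f \<circ> h = m \<circ> e\<close> is chosen, the range of \<open>m\<close>
  is mutually \<open>\<prec>\<close> with the range of \<open>m \<circ> e\<close>, since \<open>e\<close> is coarsely onto, hence with the range of
  \<open>f \<circ> h\<close>. So all members of the union that defines \<open>Sub_map\<close> coincide, and there is at least one
  by \<open>image_factorization\<close>.\<close>

lemma Sub_map_subobjects_onto:
  assumes U: "set_universe U" and X: "X \<in> Ob (Coarse U)" and Y: "Y \<in> Ob (Coarse U)"
    and f: "f \<in> Hom (Coarse U) X Y" and a: "a \<in> carrier (Pc X)"
  shows "Sub_map (Coarse U) X Y f (subobjects_onto U X a) = subobjects_onto U Y (Pc_map X Y f a)"
proof -
  let ?C = "Coarse U"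
  have Xc: "coarse_space X" and Yc: "coarse_space Y" using X Y by (simp_all add: Coarse_simps)
  obtain S where S: "S \<subseteq> carrier X" "a = coarse_subspace X S" using a by (auto simp: Pc_simps)
  obtain \<xi> where \<xi>: "\<xi> \<in> CtrTotRel X Y" "f = mor X Y \<xi>" using f by (rule Coarse_HomE)
  have pc: "Pc_map X Y f a = coarse_subspace Y (rel_image \<xi> S)"
    using Pc_map_mor[OF Xc Yc \<xi>(1) S(1)] S(2) \<xi>(2) by simp
  have same: "iso_over ?C Y `` {(I, m)} = subobjects_onto U Y (Pc_map X Y f a)"
    if h: "(Z, h) \<in> subobjects_onto U X a" and I: "I \<in> Ob ?C" and e: "epic ?C Z I e"
      and m: "monic ?C I Y m" and eq: "Comp ?C Z X Y f h = Comp ?C Z I Y m e" for Z h I m e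
  proof -
    obtain \<eta> where \<eta>: "Z \<in> Ob ?C" "\<eta> \<in> CtrTotRel Z X" "h = mor Z X \<eta>"
      "set_prec X S (Domain \<eta>)" "set_prec X (Domain \<eta>) S"
      using subobjects_ontoE[OF U X S(1)] h S(2) by metis
    have Zc: "coarse_space Z" and Ic: "coarse_space I" using \<eta>(1) I by (simp_all add: Coarse_simps)
    obtain \<epsilon> where \<epsilon>: "\<epsilon> \<in> CtrTotRel Z I" "e = mor Z I \<epsilon>"
      using e unfolding epic_def by (elim conjE Coarse_HomE)
    obtain \<mu> where \<mu>: "\<mu> \<in> CtrTotRel I Y" "m = mor I Y \<mu>"
      using m unfolding monic_def by (elim conjE Coarse_HomE)
    have "mor Z Y (\<xi> O \<eta>) = mor Z Y (\<mu> O \<epsilon>)"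
      using eq Comp_mor[OF Zc Xc Yc \<eta>(2) \<xi>(1)] Comp_mor[OF Zc Ic Yc \<epsilon>(1) \<mu>(1)] \<xi>(2) \<eta>(3) \<epsilon>(2) \<mu>(2)
        by simp
    then have sim: "(Domain (\<xi> O \<eta>), Domain (\<mu> O \<epsilon>)) \<in> set_sim Y"
      using mor_Domain_sim[OF Zc Yc CtrTotRel_comp[OF \<eta>(2) \<xi>(1)]]
        mor_self[OF Zc Yc CtrTotRel_comp[OF \<epsilon>(1) \<mu>(1)]] by simp
    have "set_prec I (carrier I) (Domain \<epsilon>)" using epic_mor_iff[OF U \<eta>(1) I \<epsilon>(1)] e \<epsilon>(2) by simp
    then have "set_prec Y (rel_image \<mu> (carrier I)) (rel_image \<mu> (Domain \<epsilon>))"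
      by (rule set_prec_rel_image[OF Ic \<mu>(1)])
    moreover have "rel_image \<mu> (Domain \<epsilon>) = Domain (\<mu> O \<epsilon>)"
      "rel_image \<xi> (Domain \<eta>) = Domain (\<xi> O \<eta>)"
      unfolding rel_image_def by blast+
    moreover note Domain_eq_rel_image[OF \<mu>(1)]
    moreover have "set_prec Y (Domain (\<mu> O \<epsilon>)) (Domain \<mu>)"
      using Domain_carrier[OF \<mu>(1)] by (intro set_prec_subset[OF Yc]) auto
    moreover have "set_prec Y (rel_image \<xi> S) (rel_image \<xi> (Domain \<eta>))"
      "set_prec Y (rel_image \<xi> (Domain \<eta>)) (rel_image \<xi> S)"
      using set_prec_rel_image[OF Xc \<xi>(1)] \<eta>(4,5) by blast+
    moreover have "set_prec Y (Domain (\<xi> O \<eta>)) (Domain (\<mu> O \<epsilon>))"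
      "set_prec Y (Domain (\<mu> O \<epsilon>)) (Domain (\<xi> O \<eta>))"
      using sim by (auto simp: set_sim_def)
    ultimately have "set_prec Y (Domain \<mu>) (rel_image \<xi> S)" "set_prec Y (rel_image \<xi> S) (Domain \<mu>)"
      using set_prec_trans[OF Yc] by metis+
    then have "coarse_subspace Y (Domain \<mu>) = Pc_map X Y f a"
      unfolding pc using Domain_carrier[OF \<mu>(1)] rel_image_carrier[OF \<xi>(1)]
        by (intro coarse_subspace_eqI[OF Yc])
    moreover have "(I, mor I Y \<mu>) \<in> monos_into ?C Y" using I m \<mu>(2) by (simp add: monos_into_def)
    ultimately show ?thesis using iso_over_class_eq[OF U Y _ \<mu>(1)] \<mu>(2) by simp
  qed
  obtain Z h where h: "(Z, h) \<in> subobjects_onto U X a"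
    using restriction_mem_subobjects_onto[OF U X S(1)] S(2) by blast
  obtain \<eta> where \<eta>: "Z \<in> Ob ?C" "\<eta> \<in> CtrTotRel Z X" "h = mor Z X \<eta>"
    using subobjects_ontoE[OF U X S(1)] h S(2) by metis
  have Zc: "coarse_space Z" using \<eta>(1) by (simp add: Coarse_simps)
  have "Comp ?C Z X Y f h = mor Z Y (\<xi> O \<eta>)" using Comp_mor[OF Zc Xc Yc \<eta>(2) \<xi>(1)] \<eta>(3) \<xi>(2) by simp
  then have "\<exists>I m e. I \<in> Ob ?C \<and> epic ?C Z I e \<and> monic ?C I Y m \<and> Comp ?C Z X Y f h = Comp ?C Z I Y m e"
    using image_factorization[OF U \<eta>(1) Y CtrTotRel_comp[OF \<eta>(2) \<xi>(1)]] by metis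
  then have "{iso_over ?C Y `` {(I, m)} | Z h I m e. (Z, h) \<in> subobjects_onto U X a \<and> I \<in> Ob ?C \<and>
      epic ?C Z I e \<and> monic ?C I Y m \<and> Comp ?C Z X Y f h = Comp ?C Z I Y m e} =
      {subobjects_onto U Y (Pc_map X Y f a)}"
    using h same by blast
  moreover have "subobjects_onto U X a \<in> carrier (Sub ?C X)"
    using carrier_Sub_Coarse[OF U X] a by simp
  ultimately show ?thesis unfolding Sub_map_def by simp
qed

theorem theorem6p1:
  fixes U :: "'a set set"
  assumes "set_universe U"
  shows "(\<forall>X \<in> Ob (Coarse U).
            isomorphic FJ_Par (FOb Pc_functor X) (FOb (Sub_functor U) X)) \<and>
         naturally_isomorphic (Coarse U) FJ_Par Pc_functor (Sub_functor U)"
proof -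
  let ?C = "Coarse U" and ?Pc = "\<lparr>FOb = Pc, FMor = Pc_map\<rparr>"
  let ?Sub = "\<lparr>FOb = Sub ?C, FMor = Sub_map ?C\<rparr>"
  have "transport ?C ?Pc (\<lambda>X a. a) ?Pc"
    by (auto simp: transport_def order_iso_def bij_betw_def Pc_simps(2) Pc_map_extensional)
  then have Pc: "transport ?C ?Pc (\<lambda>X. Inl \<circ> (\<lambda>a. a)) Pc_functor"
    by (rule transport_rename) (simp_all add: Pc_functor_def)
  have "transport ?C ?Pc (subobjects_onto U) ?Sub"
    using order_iso_Pc_Sub[OF assms] Sub_map_subobjects_onto[OF assms]
    by (simp add: transport_def Sub_map_def[of ?C])
  then have "transport ?C ?Pc (\<lambda>X. Inr \<circ> subobjects_onto U X) (Sub_functor U)"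
    by (rule transport_rename) (simp_all add: Sub_functor_def)
  with Pc have nat: "naturally_isomorphic ?C FJ_Par Pc_functor (Sub_functor U)"
    by (rule transport_naturally_isomorphic[OF cat_functor_Pc])
  then have "isomorphic FJ_Par (FOb Pc_functor X) (FOb (Sub_functor U) X)" if "X \<in> Ob ?C" for X
    using that by (rule naturally_isomorphic_imp_isomorphic)
  with nat show ?thesis by blast
qed

end
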